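(* Let $W\subset\mathbb{R}^2$ be Lebesgue measurable. Let $a<b$ be real numbers, let $f:[a,b]\to\mathbb{R}$ be a $C^1$ function with a strictly monotone derivative, and let $\Gamma=\{(t,f(t)):t\in[a,b]\}\subset\mathbb{R}^2$ be the graph of $f$. Then there exists a set $E\subset\mathbb{R}^2$ such that (a) $E+\Gamma\supset W$, (b) $|(E+\Gamma)\setminus W|=0$.
   Context: $E+\Gamma=\{x+y:x\in E,\ y\in\Gamma\}$ is the Minkowski sum, i.e. the union of the translates $x+\Gamma$, $x\in E$. $|\cdot|$ denotes Lebesgue measure in the plane. *)

theory Defs
  imports "HOL-Analysis.Analysis" "HOL-Library.Set_Algebras"
begin

(* The plane is the product type real \<times> real. The Minkowski sum is the library's
   pointwise addition of sets from Set_Algebras. *)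

definition graph_on :: "(real \<Rightarrow> real) \<Rightarrow> real set \<Rightarrow> (real \<times> real) set" where
  "graph_on f S = {(t, f t) | t. t \<in> S}"

end

(*
For a point e = (x, y) the translate e + Gamma meets the vertical line of abscissa u in the point
y + f (u - x) =: proj_u e.  So E has to be chosen with proj_u E covering the slice of W at u, with
no waste in measure for almost every u.

The heart is a Venetian blind construction.  Call a level curve of proj_w a w-curve.  The measure
of proj_u on a w-curve is small when u is close to w, and by strict monotonicity of f' a w-curve
with w > s is carried by every proj_u, u <= s, increasingly onto an interval.  Cut a w-curve into
tiny bits and replace every bit by the bit of a w'-curve, w' slightly below w, that starts at the
same point and has the same image under proj_s: then proj_u still covers for all u <= s, and the
total length of proj_s is unchanged, however often this is repeated.  Moving w down to s in small
steps makes proj_u small for every u in (s, M], whereas the set hardly moves.  Reflections do the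
same on the other side.  Hence a small disc of translation vectors can be replaced by a
nearby compact set which still covers a small neighbourhood of a given point and wastes as little
measure as desired outside a given open set around it.

Iterate this with open sets V_k containing W, |V_k - W| -> 0, along a countably branching tree of
open sets of translation vectors with nested compact closures.  By compactness, the covering at all
levels of a branch becomes a covering by the intersection of the branch.
*)
theory Submission
  imports Defs
begin

section \<open>Vertical slices of sums with a graph\<close>

definition shift_proj :: "(real \<Rightarrow> real) \<Rightarrow> real \<Rightarrow> real \<times> real \<Rightarrow> real" where
  "shift_proj F u e = snd e + F (u - fst e)"

text \<open>\<open>I\<close> holds the abscissas whose slices must stay covered, \<open>B\<close>
  those whose slices are to become small. Since \<open>E\<close>, \<open>\<delta>\<close> and
  \<open>\<epsilon>\<close> range freely, a replacement can be applied again to each of finitely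
  many pieces produced by an earlier one; this is how \<open>B\<close> gets enlarged.\<close>

definition killable :: "(real \<Rightarrow> real) \<Rightarrow> real set \<Rightarrow> real set \<Rightarrow> bool" where
  "killable F I B \<longleftrightarrow> (\<forall>E \<delta> \<epsilon>. compact E \<and> 0 < \<delta> \<and> 0 < \<epsilon> \<longrightarrow>
     (\<exists>E'. compact E' \<and> E' \<subseteq> (\<Union>e\<in>E. cball e \<delta>) \<and>
       (\<forall>u\<in>I. shift_proj F u ` E \<subseteq> shift_proj F u ` E') \<and>
       (\<forall>u\<in>B. emeasure lborel (shift_proj F u ` E') \<le> ennreal \<epsilon>)))"

lemma killableD:
  assumes "killable F I B" "compact E" "0 < \<delta>" "0 < \<epsilon>"
  obtains E' where "compact E'" "E' \<subseteq> (\<Union>e\<in>E. cball e \<delta>)"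
    "\<And>u. u \<in> I \<Longrightarrow> shift_proj F u ` E \<subseteq> shift_proj F u ` E'"
    "\<And>u. u \<in> B \<Longrightarrow> emeasure lborel (shift_proj F u ` E') \<le> ennreal \<epsilon>"
  using assms unfolding killable_def by metis

lemma killable_empty: "killable F I {}"
  unfolding killable_def
proof (intro allI impI, elim conjE)
  fix E :: "(real \<times> real) set" and \<delta> \<epsilon> :: real
  assume "compact E" "0 < \<delta>"
  moreover from \<open>0 < \<delta>\<close> have "E \<subseteq> (\<Union>e\<in>E. cball e \<delta>)" by force
  ultimately show "\<exists>E'. compact E' \<and> E' \<subseteq> (\<Union>e\<in>E. cball e \<delta>) \<and>
       (\<forall>u\<in>I. shift_proj F u ` E \<subseteq> shift_proj F u ` E') \<and>
       (\<forall>u\<in>{}. emeasure lborel (shift_proj F u ` E') \<le> ennreal \<epsilon>)"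
    by blast
qed

section \<open>Projections of compact sets: measurability, Lipschitz bounds, subadditivity\<close>

lemma continuous_on_shift_proj:
  assumes "continuous_on UNIV F"
  shows "continuous_on S (shift_proj F u)"
  unfolding shift_proj_def
  by (intro continuous_intros continuous_on_compose2[OF assms]) auto

lemma sets_shift_proj_image:
  assumes "continuous_on UNIV F" "compact E"
  shows "shift_proj F u ` E \<in> sets lborel"
  using assms
  by (metis borel_compact compact_continuous_image continuous_on_shift_proj sets_lborel)

lemma dist_prod_le:
  fixes p q :: "real \<times> real"
  shows "dist p q \<le> \<bar>fst p - fst q\<bar> + \<bar>snd p - snd q\<bar>"
  by (simp add: dist_prod_def dist_real_def sqrt_sum_squares_le_sum_abs)

lemma abs_fst_diff_le_dist: "\<bar>fst p - fst q\<bar> \<le> dist p (q :: real \<times> real)"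
  using dist_fst_le[of p q] by (simp add: dist_real_def)

lemma abs_snd_diff_le_dist: "\<bar>snd p - snd q\<bar> \<le> dist p (q :: real \<times> real)"
  using dist_snd_le[of p q] by (simp add: dist_real_def)

lemma shift_proj_lipschitz:
  assumes "\<bar>F (u - fst p) - F (u - fst q)\<bar> \<le> C * \<bar>fst p - fst q\<bar>" "0 \<le> C"
  shows "\<bar>shift_proj F u p - shift_proj F u q\<bar> \<le> (1 + C) * dist p q"
proof -
  have "C * \<bar>fst p - fst q\<bar> \<le> C * dist p q"
    using assms(2) by (intro mult_left_mono abs_fst_diff_le_dist)
  then show ?thesis
    using assms(1) abs_snd_diff_le_dist[of p q] by (simp add: shift_proj_def distrib_right)
qed

lemma emeasure_shift_proj_UN_le:
  assumes "finite J" "continuous_on UNIV F" "\<And>j. j \<in> J \<Longrightarrow> compact (E j)" "\<And>j. j \<in> J \<Longrightarrow> 0 \<le> m j"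
    and "\<And>j. j \<in> J \<Longrightarrow> emeasure lborel (shift_proj F u ` E j) \<le> ennreal (m j)"
  shows "emeasure lborel (shift_proj F u ` (\<Union>j\<in>J. E j)) \<le> ennreal (\<Sum>j\<in>J. m j)"
proof -
  have "emeasure lborel (\<Union>j\<in>J. shift_proj F u ` E j) \<le> (\<Sum>j\<in>J. emeasure lborel (shift_proj F u ` E j))"
    using assms sets_shift_proj_image[of F] by (intro emeasure_subadditive_finite) auto
  also have "\<dots> \<le> (\<Sum>j\<in>J. ennreal (m j))" using assms by (intro sum_mono)
  also have "\<dots> = ennreal (\<Sum>j\<in>J. m j)" using assms by (intro sum_ennreal)
  finally show ?thesis by (simp add: image_UN)
qed

text \<open>The isometric involution \<open>T\<close> turns slices for \<open>F\<close> at
  \<open>u\<close> into slices for \<open>G\<close> at \<open>\<sigma> u\<close>, up to the sign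
  change \<open>\<tau>\<close>, which preserves Lebesgue measure. So the image of \<open>E\<close>
  under \<open>T\<close> is replaced, and the result is carried back by \<open>T\<close>. This
  serves the reflections in the two coordinate axes.\<close>

lemma killable_isometry:
  fixes T :: "real \<times> real \<Rightarrow> real \<times> real" and \<sigma> \<tau> :: "real \<Rightarrow> real"
  assumes kill: "killable G (\<sigma> ` I) (\<sigma> ` B)"
    and T: "\<And>p q. dist (T p) (T q) = dist p q" "\<And>p. T (T p) = p"
    and proj: "\<And>u p. shift_proj G (\<sigma> u) (T p) = \<tau> (shift_proj F u p)"
    and \<tau>: "\<tau> = (\<lambda>v. v) \<or> \<tau> = uminus"
    and F: "continuous_on UNIV F"
  shows "killable F I B"
  unfolding killable_def
proof (intro allI impI, elim conjE)
  fix E :: "(real \<times> real) set" and \<delta> \<epsilon> :: real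
  assume E: "compact E" and \<delta>: "0 < \<delta>" and \<epsilon>: "0 < \<epsilon>"
  have contT: "continuous_on S T" for S
    unfolding continuous_on_iff using T(1) by metis
  have \<tau>\<tau>: "\<tau> (\<tau> v) = v" for v using \<tau> by auto
  have pr: "shift_proj F u ` (T ` S) = \<tau> ` (shift_proj G (\<sigma> u) ` S)" for u S
  proof -
    have "shift_proj F u (T p) = \<tau> (shift_proj G (\<sigma> u) p)" for p
      using proj[of u "T p"] T(2) \<tau>\<tau> by metis
    then show ?thesis by (simp add: image_image)
  qed
  have TT: "T ` T ` S = S" for S by (simp add: image_image T(2))
  obtain E' where E': "compact E'" "E' \<subseteq> (\<Union>e\<in>T ` E. cball e \<delta>)"
    "\<And>u. u \<in> \<sigma> ` I \<Longrightarrow> shift_proj G u ` T ` E \<subseteq> shift_proj G u ` E'"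
    "\<And>u. u \<in> \<sigma> ` B \<Longrightarrow> emeasure lborel (shift_proj G u ` E') \<le> ennreal \<epsilon>"
    using killableD[OF kill compact_continuous_image[OF contT E] \<delta> \<epsilon>] by metis
  show "\<exists>E'. compact E' \<and> E' \<subseteq> (\<Union>e\<in>E. cball e \<delta>) \<and>
       (\<forall>u\<in>I. shift_proj F u ` E \<subseteq> shift_proj F u ` E') \<and>
       (\<forall>u\<in>B. emeasure lborel (shift_proj F u ` E') \<le> ennreal \<epsilon>)"
  proof (intro exI[of _ "T ` E'"] conjI ballI)
    show "compact (T ` E')" by (rule compact_continuous_image[OF contT E'(1)])
    show "T ` E' \<subseteq> (\<Union>e\<in>E. cball e \<delta>)"
    proof
      fix q assume "q \<in> T ` E'"
      then obtain e' where "e' \<in> E'" "q = T e'" by auto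
      then obtain e where "e \<in> E" "dist (T e) e' \<le> \<delta>" using E'(2) by auto
      then show "q \<in> (\<Union>e\<in>E. cball e \<delta>)"
        using T(1)[of e q] T(2) \<open>q = T e'\<close> by (auto simp del: split_paired_All intro!: bexI[of _ e])
    qed
    show "shift_proj F u ` E \<subseteq> shift_proj F u ` T ` E'" if "u \<in> I" for u
      using E'(3)[of "\<sigma> u"] pr[of u E'] pr[of u "T ` E"] TT[of E] that
      by (metis image_eqI image_mono)
    show "emeasure lborel (shift_proj F u ` T ` E') \<le> ennreal \<epsilon>" if "u \<in> B" for u
    proof -
      have m: "shift_proj F u ` T ` E' \<in> sets lborel"
        by (rule sets_shift_proj_image[OF F compact_continuous_image[OF contT E'(1)]])
      have "emeasure lborel (\<tau> ` A) = emeasure lborel A" if "\<tau> ` A \<in> sets lborel" for A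
        using \<tau>
      proof
        assume u: "\<tau> = uminus"
        have "emeasure lborel (uminus ` A) = emeasure (distr lborel borel uminus) (uminus ` A)"
          by (simp add: lborel_distr_uminus)
        also have "\<dots> = emeasure lborel (uminus -` (uminus ` A))"
          using that u by (subst emeasure_distr) auto
        also have "uminus -` (uminus ` A) = A" by auto
        finally show ?thesis using u by simp
      qed simp
      then show ?thesis using m pr[of u E'] E'(4)[of "\<sigma> u"] that by auto
    qed
  qed
qed

lemma killable_mirror:
  assumes "killable (\<lambda>t. F (- t)) (uminus ` I) (uminus ` B)" "continuous_on UNIV F"
  shows "killable F I B"
proof (rule killable_isometry[OF assms(1) _ _ _ _ assms(2)])
  let ?T = "\<lambda>p :: real \<times> real. (- fst p, snd p)"
  show "dist (?T p) (?T q) = dist p q" for p q by (simp add: dist_prod_def dist_real_def abs_minus_commute)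
  show "?T (?T p) = p" for p by simp
  show "shift_proj (\<lambda>t. F (- t)) (- u) (?T p) = (\<lambda>v. v) (shift_proj F u p)" for u p
    by (simp add: shift_proj_def)
qed auto

lemma killable_uminus:
  assumes "killable (\<lambda>t. - F t) I B" "continuous_on UNIV F"
  shows "killable F I B"
proof (rule killable_isometry[where \<sigma> = "\<lambda>u. u", OF _ _ _ _ _ assms(2)])
  let ?T = "\<lambda>p :: real \<times> real. (fst p, - snd p)"
  show "dist (?T p) (?T q) = dist p q" for p q by (simp add: dist_prod_def dist_real_def abs_minus_commute)
  show "?T (?T p) = p" for p by simp
  show "shift_proj (\<lambda>t. - F t) u (?T p) = uminus (shift_proj F u p)" for u p
    by (simp add: shift_proj_def)
qed (use assms in auto)

section \<open>Level curves of the slice maps\<close>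

locale C1_strictly_convex =
  fixes F F' :: "real \<Rightarrow> real"
  assumes deriv: "\<And>t. (F has_real_derivative F' t) (at t)"
    and cont_deriv: "continuous_on UNIV F'"
    and mono_deriv: "strict_mono F'"
begin

lemma cont: "continuous_on S F"
  by (meson DERIV_continuous continuous_at_imp_continuous_on deriv)

text \<open>The change of \<open>shift_proj F u\<close> from abscissa \<open>x\<close> to
  \<open>x'\<close> along a level curve of \<open>shift_proj F w\<close>; it is the same on all
  \<open>w\<close>-curves and equals the integral of \<open>F' (w - t) - F' (u - t)\<close> over
  \<open>t\<close> from \<open>x\<close> to \<open>x'\<close>.\<close>

definition gain :: "real \<Rightarrow> real \<Rightarrow> real \<Rightarrow> real \<Rightarrow> real" where
  "gain w u x x' = (F (w - x) - F (w - x')) - (F (u - x) - F (u - x'))"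

text \<open>Level curves of \<open>shift_proj F w\<close> are graphs over the first coordinate, so
  \<open>x\<close> parametrises the one through \<open>p\<close>.\<close>

definition level :: "real \<Rightarrow> real \<times> real \<Rightarrow> real \<Rightarrow> real \<times> real" where
  "level w p x = (x, snd p + F (w - fst p) - F (w - x))"

lemma fst_level [simp]: "fst (level w p x) = x"
  by (simp add: level_def)

lemma level_level [simp]: "level w (level w p x) x' = level w p x'"
  by (simp add: level_def)

lemma shift_proj_level: "shift_proj F u (level w p x) = shift_proj F u p + gain w u (fst p) x"
  by (simp add: shift_proj_def level_def gain_def)

lemma continuous_on_level: "continuous_on S (level w p)"
  unfolding level_def by (intro continuous_intros continuous_on_compose2[OF cont[of UNIV]]) auto

lemma continuous_on_gain: "continuous_on S (gain w u x)"
  unfolding gain_def by (intro continuous_intros continuous_on_compose2[OF cont[of UNIV]]) auto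

section \<open>Cocycle identities and monotonicity of the gain\<close>

lemma gain_same [simp]: "gain w u x x = 0" "gain w w x x' = 0"
  by (simp_all add: gain_def)

lemma gain_add: "gain w u x x' + gain w u x' x'' = gain w u x x''"
  by (simp add: gain_def)

lemma gain_trans: "gain w u x x' + gain u v x x' = gain w v x x'"
  by (simp add: gain_def)

lemma gain_swap: "gain u w x x' = - gain w u x x'"
  by (simp add: gain_def)

text \<open>The derivative of the gain in its last argument is a difference of two values of
  \<open>F'\<close>, so a lower bound \<open>k\<close> integrates up. A negative \<open>k\<close>
  together with \<open>gain_swap\<close> yields upper bounds.\<close>

lemma gain_ge:
  assumes "x \<le> x'" and k: "\<And>t. x \<le> t \<Longrightarrow> t \<le> x' \<Longrightarrow> k \<le> F' (w - t) - F' (u - t)"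
  shows "k * (x' - x) \<le> gain w u x x'"
proof -
  have "F (u - x) - F (w - x) - k * x \<le> F (u - x') - F (w - x') - k * x'"
  proof (rule DERIV_nonneg_imp_nondecreasing[OF assms(1)])
    fix t assume t: "x \<le> t" "t \<le> x'"
    have "((\<lambda>t. F (u - t) - F (w - t) - k * t) has_real_derivative
        F' (u - t) * (0 - 1) - F' (w - t) * (0 - 1) - k * 1) (at t)"
      by (intro DERIV_diff DERIV_chain2[OF deriv] DERIV_const DERIV_ident DERIV_cmult)
    then show "\<exists>y. ((\<lambda>t. F (u - t) - F (w - t) - k * t) has_real_derivative y) (at t) \<and> 0 \<le> y"
      using k[OF t] by (intro exI conjI) auto
  qed
  then show ?thesis by (simp add: gain_def algebra_simps)
qed

lemma gain_nonneg:
  assumes "x \<le> x'" "u \<le> w"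
  shows "0 \<le> gain w u x x'"
proof -
  have "0 * (x' - x) \<le> gain w u x x'"
    using assms mono_deriv by (intro gain_ge) (auto simp: strict_mono_less_eq)
  then show ?thesis by simp
qed

lemma gain_mono:
  assumes "x \<le> x'" "x' \<le> x''" "u \<le> w"
  shows "gain w u x x' \<le> gain w u x x''"
  using gain_nonneg[of x' x'' u w] gain_add[of w u x x' x''] assms by simp

text \<open>A bit of a \<open>w\<close>-level curve is replaced by a longer bit of a \<open>w'\<close>-level curve through the
  same starting point; keeping the gain towards \<open>s\<close> fixed makes the total gain of all pieces
  an invariant of the construction.\<close>

lemma exists_equal_gain:
  assumes "x \<le> x'" "x' \<le> x + d" "s \<le> w'" "w' \<le> w"
    and "gain w s x x' \<le> gain w' s x (x + d)"
  obtains x'' where "x' \<le> x''" "x'' \<le> x + d" "gain w' s x x'' = gain w s x x'"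
proof -
  have "gain w' s x x' \<le> gain w s x x'"
    using gain_nonneg[of x x' w' w] gain_trans[of w w' x x' s] assms by simp
  then show thesis
    using IVT'[of "gain w' s x" x' "gain w s x x'" "x + d"] assms continuous_on_gain that by blast
qed

text \<open>Split the gain towards \<open>u\<close> at \<open>s\<close>: the parts from
  \<open>w\<close> and from \<open>w'\<close> to \<open>s\<close> agree by \<open>eq\<close>, while
  the part from \<open>s\<close> to \<open>u\<close> can only grow because \<open>x''\<close> lies
  beyond \<open>x'\<close>. So under \<open>shift_proj F u\<close> the \<open>w'\<close>-bit reaches
  at least as far as the \<open>w\<close>-bit; both start at \<open>p\<close>, and the intermediate
  value theorem fills in the rest.\<close>

lemma level_image_cover:
  assumes "u \<le> s" "s \<le> w'" "w' \<le> w" "fst p \<le> x" "x \<le> x'" "x' \<le> x''"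
    and eq: "gain w' s (fst p) x'' = gain w s (fst p) x'"
  shows "shift_proj F u (level w p x) \<in> shift_proj F u ` level w' p ` {fst p..x''}"
proof -
  let ?a = "fst p"
  have "gain w u ?a x \<le> gain w u ?a x'" using assms by (intro gain_mono) auto
  also have "\<dots> = gain w' s ?a x'' + gain s u ?a x'" using eq gain_trans by metis
  also have "\<dots> \<le> gain w' s ?a x'' + gain s u ?a x''"
    using assms by (intro add_left_mono gain_mono) auto
  also have "\<dots> = gain w' u ?a x''" by (rule gain_trans)
  finally have "gain w u ?a x \<le> gain w' u ?a x''" .
  moreover have "gain w' u ?a ?a \<le> gain w u ?a x" using assms gain_nonneg[of ?a x u w] by simp
  ultimately obtain z where "?a \<le> z" "z \<le> x''" "gain w' u ?a z = gain w u ?a x"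
    using IVT'[of "gain w' u ?a" ?a "gain w u ?a x" x''] assms continuous_on_gain by force
  then show ?thesis by (auto simp: image_image shift_proj_level intro!: image_eqI[of _ _ z])
qed

section \<open>The Venetian blind on a single arc\<close>

lemma sum_gain_partition:
  "(\<Sum>j<n. gain w u (x0 + real j * h) (x0 + real (Suc j) * h)) = gain w u x0 (x0 + real n * h)"
proof (induction n)
  case (Suc n)
  then show ?case
    using gain_add[of w u x0 "x0 + real n * h" "x0 + real (Suc n) * h"] by simp
qed simp

text \<open>On the arc itself the projection runs through an interval whose length is the gain, and
  a displacement by \<open>\<delta>\<close> changes it by at most
  \<open>(1 + C) * \<delta>\<close>.\<close>

lemma emeasure_near_level_le:
  assumes E: "E \<subseteq> (\<Union>e\<in>level w p ` {fst p..x'}. cball e \<delta>)" and uw: "u \<le> w" "fst p \<le> x'"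
    and lip: "\<And>x x'. \<bar>x\<bar> \<le> R \<Longrightarrow> \<bar>x'\<bar> \<le> R \<Longrightarrow> \<bar>F (u - x) - F (u - x')\<bar> \<le> C * \<bar>x - x'\<bar>"
    and C: "0 \<le> C" and R: "- R \<le> fst p - \<delta>" "x' + \<delta> \<le> R" and "0 \<le> \<delta>"
  shows "emeasure lborel (shift_proj F u ` E) \<le> ennreal (gain w u (fst p) x' + 2 * (1 + C) * \<delta>)"
proof -
  let ?l = "shift_proj F u p - (1 + C) * \<delta>" and ?r = "shift_proj F u p + gain w u (fst p) x' + (1 + C) * \<delta>"
  have "shift_proj F u ` E \<subseteq> {?l..?r}"
  proof
    fix v assume "v \<in> shift_proj F u ` E"
    then obtain e x where e: "v = shift_proj F u e" "fst p \<le> x" "x \<le> x'" "dist (level w p x) e \<le> \<delta>"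
      using E by fastforce
    have "\<bar>x - fst e\<bar> \<le> \<delta>" using abs_fst_diff_le_dist[of "level w p x" e] e(4) by simp
    then have "\<bar>shift_proj F u (level w p x) - shift_proj F u e\<bar> \<le> (1 + C) * dist (level w p x) e"
      using e R C \<open>0 \<le> \<delta>\<close> by (intro shift_proj_lipschitz lip) auto
    also have "\<dots> \<le> (1 + C) * \<delta>" using e(4) C by (intro mult_left_mono) auto
    finally have "\<bar>shift_proj F u p + gain w u (fst p) x - v\<bar> \<le> (1 + C) * \<delta>"
      by (simp add: shift_proj_level e(1))
    moreover have "0 \<le> gain w u (fst p) x" "gain w u (fst p) x \<le> gain w u (fst p) x'"
      using e uw by (auto intro: gain_nonneg gain_mono)
    ultimately show "v \<in> {?l..?r}" by auto
  qed
  then have "emeasure lborel (shift_proj F u ` E) \<le> emeasure lborel {?l..?r}"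
    by (intro emeasure_mono) auto
  moreover have "0 \<le> gain w u (fst p) x'" using uw by (rule gain_nonneg[rotated])
  ultimately show ?thesis using C \<open>0 \<le> \<delta>\<close> by (simp add: algebra_simps)
qed

text \<open>Induction on the number \<open>n\<close> of descents by at most \<open>\<eta>\<close>
  leading from \<open>w\<close> down to \<open>w0\<close>. In one descent the arc is cut into short
  bits, each exchanged for a \<open>w'\<close>-bit with the same gain towards \<open>s\<close>. As
  the bound is \<open>\<theta>\<close> times this gain, the bounds of the bits add up to that of the
  whole arc, and no loss accumulates.\<close>

lemma level_replace:
  assumes kill: "killable F I B" and I: "\<And>u. u \<in> I \<Longrightarrow> u \<le> s"
    and pos: "s \<le> w0" "0 < c" "0 \<le> C" "0 < \<eta>" "0 < \<theta>"
    and gap: "\<And>w x. w0 \<le> w \<Longrightarrow> \<bar>x\<bar> \<le> R \<Longrightarrow> c \<le> F' (w - x) - F' (s - x)"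
    and lip: "\<And>w x x'. s \<le> w \<Longrightarrow> w \<le> M \<Longrightarrow> \<bar>x\<bar> \<le> R \<Longrightarrow> \<bar>x'\<bar> \<le> R \<Longrightarrow>
                \<bar>F (w - x) - F (w - x')\<bar> \<le> C * \<bar>x - x'\<bar>"
    and osc: "\<And>u w x. s \<le> u \<Longrightarrow> u \<le> w \<Longrightarrow> w \<le> M \<Longrightarrow> w - u \<le> \<eta> \<Longrightarrow> \<bar>x\<bar> \<le> R \<Longrightarrow>
                F' (w - x) - F' (u - x) \<le> c * \<theta> / 2"
    and "w0 \<le> w" "w \<le> M" "w \<le> w0 + real n * \<eta>" "fst p < x1" "0 < \<delta>"
      "- R \<le> fst p - \<delta>" "x1 + \<delta> \<le> R"
  shows "\<exists>E. compact E \<and> E \<subseteq> (\<Union>e\<in>level w p ` {fst p..x1}. cball e \<delta>) \<and>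
     (\<forall>u\<in>I. shift_proj F u ` level w p ` {fst p..x1} \<subseteq> shift_proj F u ` E) \<and>
     (\<forall>u\<in>B \<union> {w0<..w}. emeasure lborel (shift_proj F u ` E) \<le> ennreal (\<theta> * gain w s (fst p) x1))"
  using assms(11-17)
proof (induction n arbitrary: w p x1 \<delta>)
  case 0
  let ?K = "level w p ` {fst p..x1}"
  \<comment> \<open>Here \<open>w = w0\<close>, so only \<open>B\<close> remains, and
    \<open>kill\<close> applies once the target bound is known to be positive.\<close>
  have "c * (x1 - fst p) \<le> gain w s (fst p) x1"
    using 0 by (intro gain_ge gap) auto
  moreover have "0 < c * (x1 - fst p)" using pos 0 by simp
  ultimately have "0 < \<theta> * gain w s (fst p) x1" using pos by simp
  moreover have "compact ?K" by (intro compact_continuous_image continuous_on_level) simp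
  ultimately obtain E where E: "compact E" "E \<subseteq> (\<Union>e\<in>?K. cball e \<delta>)"
    "\<And>u. u \<in> I \<Longrightarrow> shift_proj F u ` ?K \<subseteq> shift_proj F u ` E"
    "\<And>u. u \<in> B \<Longrightarrow> emeasure lborel (shift_proj F u ` E) \<le> ennreal (\<theta> * gain w s (fst p) x1)"
    using killableD[OF kill _ \<open>0 < \<delta>\<close>, of ?K "\<theta> * gain w s (fst p) x1"] by metis
  have "{w0<..w} = {}" using 0 by simp
  then show ?case
    by (intro exI[of _ E] conjI ballI E) simp_all
next
  case (Suc n)
  define a where "a = fst p"
  define len where "len = gain w s a x1"
  have "c * (x1 - a) \<le> len"
    unfolding len_def a_def using Suc.prems by (intro gain_ge gap) auto
  moreover have ax1: "a < x1" using Suc.prems by (simp add: a_def)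
  moreover have "0 < c * (x1 - a)" using pos ax1 by simp
  ultimately have len: "0 < len" "c * (x1 - a) \<le> len" by linarith+
  \<comment> \<open>One descent; the maximum keeps \<open>w'\<close> from falling below
    \<open>w0\<close>, and \<open>n\<close> further descents suffice from there.\<close>
  define w' where "w' = max w0 (w - \<eta>)"
  have w': "w0 \<le> w'" "w' \<le> w" "w' \<le> M" "w' \<le> w0 + real n * \<eta>" "w - w' \<le> \<eta>" "s \<le> w'"
    using Suc.prems pos by (auto simp: w'_def algebra_simps)
  \<comment> \<open>A \<open>\<rho>\<close>-neighbourhood of the arc adds at most
    \<open>2 * (1 + C) * \<rho>\<close> to a projection, which is at most half of
    \<open>\<theta> * len\<close>; the other half is reserved for the gain of the arc towards
    abscissas in \<open>(w', w]\<close>.\<close>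
  define \<rho> where "\<rho> = min \<delta> (\<theta> * len / (4 * (1 + C)))"
  have \<rho>: "0 < \<rho>" "\<rho> \<le> \<delta>" "4 * (1 + C) * \<rho> \<le> \<theta> * len"
  proof -
    show "0 < \<rho>" using pos len Suc.prems by (simp add: \<rho>_def)
    show "\<rho> \<le> \<delta>" by (simp add: \<rho>_def)
    have "\<rho> \<le> \<theta> * len / (4 * (1 + C))" by (simp add: \<rho>_def)
    then show "4 * (1 + C) * \<rho> \<le> \<theta> * len" using pos by (simp add: field_simps)
  qed
  \<comment> \<open>Maximal horizontal length of a new bit: by the Lipschitz bound it stays within
    \<open>\<rho> / 2\<close> of its starting point, which leaves \<open>\<rho> / 2\<close> for the
    induction hypothesis.\<close>
  define d where "d = \<rho> / (2 * (1 + C))"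
  have d: "0 < d" "(1 + C) * d = \<rho> / 2" "d \<le> \<rho> / 2"
    using pos \<rho> by (auto simp: d_def field_simps)
  \<comment> \<open>Upper bound for the mesh \<open>h\<close>: an old bit has gain at most
    \<open>2 * C * h\<close> towards \<open>s\<close>, and this must not exceed
    \<open>c * d\<close>, a lower bound for the gain of a new bit of length \<open>d\<close>. The
    summand \<open>1\<close> in the denominator covers \<open>C = 0\<close>.\<close>
  define e where "e = min d (c * d / (2 * C + 1))"
  have "0 < e" using pos d by (simp add: e_def)
  obtain N :: nat where N: "(x1 - a) / e < real N" using reals_Archimedean2 by blast
  moreover have "0 < (x1 - a) / e" using ax1 \<open>0 < e\<close> by simp
  ultimately have "0 < real N" by linarith
  then have "0 < N" by simp
  define h where "h = (x1 - a) / real N"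
  have h: "0 < h" "h \<le> d" "2 * C * h \<le> c * d" "a + real N * h = x1"
  proof -
    show "0 < h" using ax1 \<open>0 < N\<close> by (simp add: h_def)
    have "h \<le> e" using N \<open>0 < N\<close> \<open>0 < e\<close> by (simp add: h_def field_simps)
    then show "h \<le> d" by (simp add: e_def)
    have "h \<le> c * d / (2 * C + 1)" using \<open>h \<le> e\<close> by (simp add: e_def)
    then have "h * (2 * C + 1) \<le> c * d" using pos by (simp add: field_simps)
    then show "2 * C * h \<le> c * d" using \<open>0 < h\<close> by (simp add: algebra_simps)
    show "a + real N * h = x1" using \<open>0 < N\<close> by (simp add: h_def)
  qed
  define t where "t j = a + real j * h" for j
  have t: "a \<le> t j" "t j < t (Suc j)" "t (Suc j) = t j + h" for j
    using h(1) by (auto simp: t_def algebra_simps)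
  have tN: "t (Suc j) \<le> x1" if "j < N" for j
  proof -
    have "real (Suc j) * h \<le> real N * h" using that h(1) by (intro mult_right_mono) auto
    then show ?thesis using h(4) by (simp add: t_def)
  qed
  define P where "P j = level w p (t j)" for j
  have fstP: "fst (P j) = t j" for j by (simp add: P_def)
  have "\<exists>x'. \<forall>j<N. t (Suc j) \<le> x' j \<and> x' j \<le> t j + d \<and> gain w' s (t j) (x' j) = gain w s (t j) (t (Suc j))"
  proof -
    have "\<exists>x'. t (Suc j) \<le> x' \<and> x' \<le> t j + d \<and> gain w' s (t j) x' = gain w s (t j) (t (Suc j))"
      if j: "j < N" for j
    proof -
      have R: "\<bar>t j\<bar> \<le> R" "\<bar>t (Suc j)\<bar> \<le> R" "\<bar>t j + d\<bar> \<le> R"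
        using t[of j] tN[OF j] Suc.prems \<rho> d by (auto simp: a_def)
      have "\<bar>F (w - t j) - F (w - t (Suc j))\<bar> \<le> C * h" "\<bar>F (s - t j) - F (s - t (Suc j))\<bar> \<le> C * h"
        using lip[of w "t j" "t (Suc j)"] lip[of s "t j" "t (Suc j)"] R Suc.prems pos h(1) t(3)[of j] by auto
      then have "gain w s (t j) (t (Suc j)) \<le> 2 * C * h" unfolding gain_def by linarith
      also have "\<dots> \<le> c * (t j + d - t j)" using h by simp
      also have "\<dots> \<le> gain w' s (t j) (t j + d)"
        using R d w' by (intro gain_ge gap) auto
      finally have "gain w s (t j) (t (Suc j)) \<le> gain w' s (t j) (t j + d)" .
      moreover have "t j \<le> t (Suc j)" "t (Suc j) \<le> t j + d" using t[of j] h by auto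
      ultimately show ?thesis
        using exists_equal_gain[of "t j" "t (Suc j)" d s w' w] w' by blast
    qed
    then show ?thesis by (intro choice) blast
  qed
  then obtain x' where x': "\<And>j. j < N \<Longrightarrow> t (Suc j) \<le> x' j" "\<And>j. j < N \<Longrightarrow> x' j \<le> t j + d"
    "\<And>j. j < N \<Longrightarrow> gain w' s (t j) (x' j) = gain w s (t j) (t (Suc j))" by blast
  have "\<exists>E. compact E \<and> E \<subseteq> (\<Union>e\<in>level w' (P j) ` {fst (P j)..x' j}. cball e (\<rho> / 2)) \<and>
     (\<forall>u\<in>I. shift_proj F u ` level w' (P j) ` {fst (P j)..x' j} \<subseteq> shift_proj F u ` E) \<and>
     (\<forall>u\<in>B \<union> {w0<..w'}. emeasure lborel (shift_proj F u ` E) \<le> ennreal (\<theta> * gain w' s (fst (P j)) (x' j)))"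
    if "j < N" for j
  proof (rule Suc.IH)
    show "fst (P j) < x' j" "- R \<le> fst (P j) - \<rho> / 2"
      using t[of j] x'(1)[OF that] \<rho> Suc.prems by (auto simp: fstP a_def)
    show "x' j + \<rho> / 2 \<le> R"
      using x'(2)[OF that] t[of j] tN[OF that] d \<rho> Suc.prems by auto
  qed (use w' \<rho> in auto)
  then obtain D where D0: "\<And>j. j < N \<Longrightarrow> compact (D j) \<and> D j \<subseteq> (\<Union>e\<in>level w' (P j) ` {fst (P j)..x' j}. cball e (\<rho> / 2)) \<and>
     (\<forall>u\<in>I. shift_proj F u ` level w' (P j) ` {fst (P j)..x' j} \<subseteq> shift_proj F u ` D j) \<and>
     (\<forall>u\<in>B \<union> {w0<..w'}. emeasure lborel (shift_proj F u ` D j) \<le> ennreal (\<theta> * gain w' s (fst (P j)) (x' j)))"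
    by metis
  have D: "\<And>j. j < N \<Longrightarrow> compact (D j)"
    "\<And>j. j < N \<Longrightarrow> D j \<subseteq> (\<Union>e\<in>level w' (P j) ` {t j..x' j}. cball e (\<rho> / 2))"
    "\<And>j u. j < N \<Longrightarrow> u \<in> I \<Longrightarrow> shift_proj F u ` level w' (P j) ` {t j..x' j} \<subseteq> shift_proj F u ` D j"
    "\<And>j u. j < N \<Longrightarrow> u \<in> B \<union> {w0<..w'} \<Longrightarrow>
       emeasure lborel (shift_proj F u ` D j) \<le> ennreal (\<theta> * gain w s (t j) (t (Suc j)))"
    using D0 x'(3) unfolding fstP by simp_all
  define E where "E = (\<Union>j\<in>{..<N}. D j)"
  \<comment> \<open>Each point of \<open>E\<close> is close to the start \<open>P j\<close> of its
    bit, which lies on the old arc. This also controls the abscissas in \<open>(w', w]\<close>,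
    which the induction hypothesis does not reach.\<close>
  have near: "E \<subseteq> (\<Union>e\<in>level w p ` {fst p..x1}. cball e \<rho>)"
  proof
    fix q assume "q \<in> E"
    then obtain j x where j: "j < N" and x: "t j \<le> x" "x \<le> x' j" and q: "dist (level w' (P j) x) q \<le> \<rho> / 2"
      using D(2) by (fastforce simp: E_def)
    have "\<bar>F (w' - t j) - F (w' - x)\<bar> \<le> C * \<bar>t j - x\<bar>"
      using w' t[of j] x x'(2)[OF j] tN[OF j] Suc.prems d \<rho> by (intro lip) (auto simp: a_def)
    moreover have "C * \<bar>t j - x\<bar> \<le> C * d" using pos x x'(2)[OF j] by (intro mult_left_mono) auto
    moreover have "dist (P j) (level w' (P j) x) \<le> \<bar>t j - x\<bar> + \<bar>F (w' - t j) - F (w' - x)\<bar>"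
      using dist_prod_le[of "P j" "level w' (P j) x"] by (simp add: fstP level_def[of w'])
    ultimately have "dist (P j) (level w' (P j) x) \<le> (1 + C) * d"
      using x x'(2)[OF j] by (simp add: algebra_simps)
    then have "dist (P j) q \<le> \<rho>"
      using d(2) q dist_triangle[of "P j" q "level w' (P j) x"] by linarith
    moreover have "P j \<in> level w p ` {fst p..x1}"
      using t[of j] tN[OF j] by (auto simp: P_def a_def)
    ultimately show "q \<in> (\<Union>e\<in>level w p ` {fst p..x1}. cball e \<rho>)" by auto
  qed
  have cover: "shift_proj F u ` level w p ` {fst p..x1} \<subseteq> shift_proj F u ` E" if "u \<in> I" for u
  proof
    fix v assume "v \<in> shift_proj F u ` level w p ` {fst p..x1}"
    then obtain x where x: "a \<le> x" "x \<le> x1" "v = shift_proj F u (level w p x)" by (auto simp: a_def)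
    \<comment> \<open>The floor finds the bit containing \<open>x\<close>; at \<open>x = x1\<close>
      it would give \<open>N\<close>, so the last bit is taken there.\<close>
    have "\<exists>j<N. t j \<le> x \<and> x \<le> t (Suc j)"
    proof (cases "x = x1")
      case True
      then show ?thesis
        using \<open>0 < N\<close> h t(2)[of "N - 1"] by (intro exI[of _ "N - 1"]) (auto simp: t_def)
    next
      case False
      define j where "j = nat \<lfloor>(x - a) / h\<rfloor>"
      have "real j \<le> (x - a) / h" "(x - a) / h < real j + 1"
        using x h(1) by (auto simp: j_def)
      then have 1: "real j * h \<le> x - a" "x - a < (real j + 1) * h"
        using h(1) by (auto simp: field_simps)
      then have "real j * h < real N * h" using h(4) x False by linarith
      then have "j < N" using h(1) by simp
      then show ?thesis using 1 by (intro exI[of _ j]) (auto simp: t_def algebra_simps)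
    qed
    then obtain j where j: "j < N" "t j \<le> x" "x \<le> t (Suc j)" by blast
    have "shift_proj F u (level w (P j) x) \<in> shift_proj F u ` level w' (P j) ` {fst (P j)..x' j}"
      using j x' w' I[OF that] by (intro level_image_cover[of u s w' w "P j" x "t (Suc j)"]) (auto simp: fstP)
    then have "v \<in> shift_proj F u ` D j"
      using D(3)[OF j(1) that] x(3) by (auto simp: P_def)
    then show "v \<in> shift_proj F u ` E" using j(1) by (auto simp: E_def)
  qed
  have small: "emeasure lborel (shift_proj F u ` E) \<le> ennreal (\<theta> * len)" if u: "u \<in> B \<union> {w0<..w}" for u
  proof (cases "u \<in> B \<union> {w0<..w'}")
    case True
    have "emeasure lborel (shift_proj F u ` E) \<le> ennreal (\<Sum>j<N. \<theta> * gain w s (t j) (t (Suc j)))"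
      unfolding E_def using D True pos t w'
      by (intro emeasure_shift_proj_UN_le cont mult_nonneg_nonneg gain_nonneg)
         (auto simp: less_imp_le)
    also have "(\<Sum>j<N. \<theta> * gain w s (t j) (t (Suc j))) = \<theta> * len"
      using sum_gain_partition[of w s a h N] h(4)
      by (simp add: t_def len_def flip: sum_distrib_left)
    finally show ?thesis .
  next
    case False
    then have u: "w' < u" "u \<le> w" using u by auto
    \<comment> \<open>For \<open>u\<close> in \<open>(w', w]\<close> the old arc has little gain,
      since \<open>F'\<close> oscillates little between abscissas at most \<open>\<eta>\<close>
      apart. The reversed gain is bounded below and then swapped.\<close>
    have "- (c * \<theta> / 2) * (x1 - a) \<le> gain u w a x1"
    proof (rule gain_ge)
      fix z assume "a \<le> z" "z \<le> x1"
      then have "F' (w - z) - F' (u - z) \<le> c * \<theta> / 2"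
        using u w' Suc.prems by (intro osc) (auto simp: a_def)
      then show "- (c * \<theta> / 2) \<le> F' (u - z) - F' (w - z)" by simp
    qed (use ax1 in simp)
    then have "gain w u a x1 \<le> \<theta> * (c * (x1 - a)) / 2" by (simp add: gain_swap[of w u] field_simps)
    also have "\<dots> \<le> \<theta> * len / 2" using len pos by (intro divide_right_mono mult_left_mono) auto
    finally have "gain w u a x1 + 2 * (1 + C) * \<rho> \<le> \<theta> * len" using \<rho>(3) by (simp add: algebra_simps)
    moreover have "emeasure lborel (shift_proj F u ` E) \<le> ennreal (gain w u a x1 + 2 * (1 + C) * \<rho>)"
      unfolding a_def using u w' Suc.prems \<rho> pos
      by (intro emeasure_near_level_le[OF near, where R = R] lip) auto
    ultimately show ?thesis by (meson ennreal_leI order_trans)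
  qed
  show ?case
  proof (intro exI[of _ E] conjI ballI)
    show "compact E" unfolding E_def using D(1) by (intro compact_UN) auto
    show "E \<subseteq> (\<Union>e\<in>level w p ` {fst p..x1}. cball e \<delta>)"
      using near \<rho>(2) by (fastforce intro: order_trans)
  qed (use cover small in \<open>auto simp: len_def a_def\<close>)
qed

section \<open>From arcs to arbitrary compact sets of translation vectors\<close>

lemma level_image_interval:
  assumes "fst p \<le> x'" "shift_proj F u p \<le> v" "v \<le> shift_proj F u p + gain w u (fst p) x'"
  shows "v \<in> shift_proj F u ` level w p ` {fst p..x'}"
proof -
  obtain x where "fst p \<le> x" "x \<le> x'" "gain w u (fst p) x = v - shift_proj F u p"
    using IVT'[of "gain w u (fst p)" "fst p" "v - shift_proj F u p" x'] assms continuous_on_gain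
    by auto
  then show ?thesis by (auto simp: image_image shift_proj_level intro!: image_eqI[of _ _ x])
qed

lemma lipschitz_on_interval:
  obtains C where "0 \<le> C" "\<And>t t'. t \<in> {l..h} \<Longrightarrow> t' \<in> {l..h} \<Longrightarrow> \<bar>F t - F t'\<bar> \<le> C * \<bar>t - t'\<bar>"
proof -
  have "compact (F' ` {l..h})"
    by (intro compact_continuous_image continuous_on_subset[OF cont_deriv]) auto
  then obtain C where C: "0 < C" "\<And>t. t \<in> {l..h} \<Longrightarrow> \<bar>F' t\<bar> \<le> C"
    using compact_imp_bounded bounded_pos by (metis imageI real_norm_def)
  have "\<bar>F t - F t'\<bar> \<le> C * \<bar>t - t'\<bar>" if "t \<in> {l..h}" "t' \<in> {l..h}" for t t'
    using field_differentiable_bound[of "{l..h}" F F' C t t'] C deriv that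
    by (auto intro: has_field_derivative_at_within)
  with C(1) that show thesis by (meson less_imp_le)
qed

lemma uniform_osc:
  assumes "0 < \<kappa>"
  obtains \<eta> where "0 < \<eta>"
    "\<And>t t'. t \<in> {l..h} \<Longrightarrow> t' \<in> {l..h} \<Longrightarrow> \<bar>t - t'\<bar> \<le> \<eta> \<Longrightarrow> \<bar>F' t - F' t'\<bar> \<le> \<kappa>"
proof -
  have "uniformly_continuous_on {l..h} F'"
    by (intro compact_uniformly_continuous continuous_on_subset[OF cont_deriv]) auto
  then obtain \<eta> where \<eta>: "0 < \<eta>"
    "\<And>t t'. t \<in> {l..h} \<Longrightarrow> t' \<in> {l..h} \<Longrightarrow> dist t t' < \<eta> \<Longrightarrow> dist (F' t) (F' t') < \<kappa>"
    using assms unfolding uniformly_continuous_on_def by metis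
  show thesis
  proof (rule that[of "\<eta> / 2"])
    fix t t' assume "t \<in> {l..h}" "t' \<in> {l..h}" "\<bar>t - t'\<bar> \<le> \<eta> / 2"
    then show "\<bar>F' t - F' t'\<bar> \<le> \<kappa>" using \<eta>(1) \<eta>(2)[of t t'] by (auto simp: dist_real_def)
  qed (use \<eta> in simp)
qed

text \<open>Cover \<open>E\<close> by finitely many small balls and exchange each for an arc of an
  \<open>M\<close>-curve. Such an arc has gain bounded below towards all \<open>u\<close> in
  \<open>I\<close>, so if started low enough its projection covers that of the ball. The arcs are
  then handed to \<open>level_replace\<close>, which descends from \<open>M\<close> to
  \<open>w0\<close>.\<close>

lemma killable_above:
  assumes kill: "killable F I B" and I: "I \<subseteq> {r..s}" and sw0: "s < w0"
  shows "killable F I (B \<union> {w0<..M})"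
proof (cases "w0 < M")
  case False
  then show ?thesis using kill by simp
next
  case M: True
  show ?thesis
    unfolding killable_def
  proof (intro allI impI, elim conjE)
    fix E :: "(real \<times> real) set" and \<delta> \<epsilon> :: real
    assume E: "compact E" and \<delta>: "0 < \<delta>" and \<epsilon>: "0 < \<epsilon>"
    obtain R0 where R0: "\<And>e. e \<in> E \<Longrightarrow> norm e \<le> R0"
      using compact_imp_bounded[OF E] by (auto simp: bounded_iff)
    define R where "R = \<bar>R0\<bar> + \<delta>"
    have "0 < R" using \<delta> by (simp add: R_def)
    have ER: "\<bar>fst e\<bar> + \<delta> \<le> R" if "e \<in> E" for e
      using R0[OF that] norm_fst_le[of "fst e" "snd e"] by (simp add: R_def)
    obtain C where C: "0 \<le> C"
      "\<And>t t'. t \<in> {min r s - R..M + R} \<Longrightarrow> t' \<in> {min r s - R..M + R} \<Longrightarrow> \<bar>F t - F t'\<bar> \<le> C * \<bar>t - t'\<bar>"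
      using lipschitz_on_interval[of "min r s - R" "M + R"] by metis
    have lip: "\<bar>F (w - x) - F (w - x')\<bar> \<le> C * \<bar>x - x'\<bar>"
      if "min r s \<le> w" "w \<le> M" "\<bar>x\<bar> \<le> R" "\<bar>x'\<bar> \<le> R" for w x x'
    proof -
      have "w - x \<in> {min r s - R..M + R}" "w - x' \<in> {min r s - R..M + R}"
        using that unfolding abs_le_iff atLeastAtMost_iff by linarith+
      then show ?thesis using C(2)[of "w - x" "w - x'"] by (simp add: abs_minus_commute)
    qed
    \<comment> \<open>Strict monotonicity of \<open>F'\<close> and compactness of
      \<open>[-R, R]\<close> give a uniform gap; \<open>w = w0\<close> is the worst case.\<close>
    obtain c where c: "0 < c" "\<And>w x. w0 \<le> w \<Longrightarrow> \<bar>x\<bar> \<le> R \<Longrightarrow> c \<le> F' (w - x) - F' (s - x)"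
    proof -
      let ?g = "\<lambda>x. F' (w0 - x) - F' (s - x)"
      have "continuous_on {- R..R} ?g"
        by (intro continuous_intros continuous_on_compose2[OF cont_deriv]) auto
      moreover have "{- R..R} \<noteq> {}" using \<open>0 < R\<close> by simp
      ultimately obtain z where z: "\<And>x. x \<in> {- R..R} \<Longrightarrow> ?g z \<le> ?g x"
        using continuous_attains_inf[of "{- R..R}" ?g] by (metis compact_Icc)
      show thesis
      proof (rule that[of "F' (w0 - z) - F' (s - z)"])
        show "0 < F' (w0 - z) - F' (s - z)"
          using sw0 mono_deriv by (simp add: strict_mono_less)
        fix w x :: real assume "w0 \<le> w" "\<bar>x\<bar> \<le> R"
        then show "F' (w0 - z) - F' (s - z) \<le> F' (w - x) - F' (s - x)"
          using z[of x] strict_mono_less_eq[OF mono_deriv, of "w0 - x" "w - x"]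
            by (auto simp: abs_le_iff)
      qed
    qed
    define L where "L = c + 2 * (1 + C)"
    have L: "0 < L" "0 < 1 + C" using c C by (auto simp: L_def)
    \<comment> \<open>An arc of length \<open>d\<close> gains at least
      \<open>c * d = 2 * (1 + C) * \<rho>\<close>, the Lipschitz bound for the width of a projected
      \<open>\<rho>\<close>-ball. The value of \<open>\<rho>\<close> makes the displacement
      \<open>(1 + C) * \<rho> + (1 + C) * d\<close> equal to \<open>\<delta> / 2\<close>; the other
      half is left to \<open>level_replace\<close>.\<close>
    define \<rho> where "\<rho> = \<delta> * c / (2 * (1 + C) * L)"
    define d where "d = 2 * (1 + C) * \<rho> / c"
    have \<rho>: "0 < \<rho>" "0 < d" "c * d = 2 * (1 + C) * \<rho>"
    proof -
      show "0 < \<rho>" unfolding \<rho>_def using \<delta> c(1) L by (intro divide_pos_pos mult_pos_pos) auto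
      then show "0 < d" unfolding d_def using c(1) L by (intro divide_pos_pos mult_pos_pos) auto
      show "c * d = 2 * (1 + C) * \<rho>" using c(1) by (simp add: d_def)
    qed
    have \<rho>d: "(1 + C) * \<rho> + (1 + C) * d = \<delta> / 2"
    proof -
      have "\<rho> * (2 * (1 + C) * L) = \<delta> * c" unfolding \<rho>_def using L by simp
      moreover have "c * (2 * ((1 + C) * \<rho> + (1 + C) * d)) = \<rho> * (2 * (1 + C) * L)"
      proof -
        have "c * (2 * ((1 + C) * \<rho> + (1 + C) * d)) = 2 * c * (1 + C) * \<rho> + 2 * (1 + C) * (c * d)"
          by (simp add: algebra_simps)
        also have "\<dots> = \<rho> * (2 * (1 + C) * L)"
          unfolding \<rho>(3) by (simp add: L_def algebra_simps)
        finally show ?thesis .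
      qed
      ultimately show ?thesis using c(1) by (simp add: mult.commute)
    qed
    have "d \<le> (1 + C) * d" "0 \<le> (1 + C) * \<rho>" using C \<rho> by (auto simp: distrib_right)
    then have d\<delta>: "d \<le> \<delta> / 2" using \<rho>d by linarith
    obtain k where k: "finite k" "k \<subseteq> E" "E \<subseteq> (\<Union>e\<in>k. ball e \<rho>)"
      using seq_compact_imp_totally_bounded[OF compact_imp_seq_compact[OF E], rule_format, OF \<rho>(1)]
      by metis
    \<comment> \<open>Lowering the centre by \<open>(1 + C) * \<rho>\<close> starts the projected
      arc at or below every projected point of the ball.\<close>
    define p where "p e = (fst e, snd e - (1 + C) * \<rho>)" for e :: "real \<times> real"
    have p: "fst (p e) = fst e" "shift_proj F u (p e) = shift_proj F u e - (1 + C) * \<rho>" for e u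
      by (simp_all add: p_def shift_proj_def)
    have "\<exists>D. compact D \<and> D \<subseteq> (\<Union>e\<in>level M (p e) ` {fst (p e)..fst e + d}. cball e (\<delta> / 2)) \<and>
     (\<forall>u\<in>I. shift_proj F u ` level M (p e) ` {fst (p e)..fst e + d} \<subseteq> shift_proj F u ` D) \<and>
     (\<forall>u\<in>B \<union> {w0<..M}. emeasure lborel (shift_proj F u ` D) \<le> ennreal (\<epsilon> / card k))" if e: "e \<in> k" for e
    proof -
      have fe: "\<bar>fst e\<bar> + \<delta> \<le> R" using ER[of e] e k by auto
      have "0 < c * d" using c(1) \<rho>(2) by simp
      also have "c * d = c * (fst e + d - fst e)" by simp
      also have "\<dots> \<le> gain M s (fst e) (fst e + d)"
        using M fe \<rho>(2) d\<delta> \<delta> by (intro gain_ge c(2)) auto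
      finally have g: "0 < gain M s (fst e) (fst e + d)" .
      have "0 < card k" using e k(1) by (auto simp: card_gt_0_iff)
      define \<theta> where "\<theta> = \<epsilon> / card k / gain M s (fst e) (fst e + d)"
      have \<theta>: "0 < \<theta>" "\<theta> * gain M s (fst (p e)) (fst e + d) = \<epsilon> / card k"
        using g \<epsilon> \<open>0 < card k\<close> by (simp_all add: \<theta>_def p)
      obtain \<eta> where \<eta>: "0 < \<eta>" "\<And>t t'. t \<in> {s - R..M + R} \<Longrightarrow> t' \<in> {s - R..M + R} \<Longrightarrow>
          \<bar>t - t'\<bar> \<le> \<eta> \<Longrightarrow> \<bar>F' t - F' t'\<bar> \<le> c * \<theta> / 2"
        using uniform_osc[of "c * \<theta> / 2" "s - R" "M + R"] c \<theta> by auto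
      have osc: "F' (w - x) - F' (u - x) \<le> c * \<theta> / 2"
        if "s \<le> u" "u \<le> w" "w \<le> M" "w - u \<le> \<eta>" "\<bar>x\<bar> \<le> R" for u w x
      proof -
        have "w - x \<in> {s - R..M + R}" "u - x \<in> {s - R..M + R}" "\<bar>(w - x) - (u - x)\<bar> \<le> \<eta>"
          using that by (auto simp: abs_le_iff)
        then show ?thesis using \<eta>(2)[of "w - x" "u - x"] by linarith
      qed
      obtain n :: nat where "(M - w0) / \<eta> < real n" using reals_Archimedean2 by blast
      then have n: "M \<le> w0 + real n * \<eta>" using \<eta>(1) by (simp add: field_simps)
      have bounds: "s \<le> w0" "w0 \<le> M" "fst (p e) < fst e + d" "0 < \<delta> / 2"
          "- R \<le> fst (p e) - \<delta> / 2" "fst e + d + \<delta> / 2 \<le> R"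
        using sw0 M \<rho>(2) \<delta> fe d\<delta> by (auto simp: p)
      have Is: "u \<le> s" if "u \<in> I" for u using I that by auto
      have lips: "\<bar>F (w - x) - F (w - x')\<bar> \<le> C * \<bar>x - x'\<bar>"
        if "s \<le> w" "w \<le> M" "\<bar>x\<bar> \<le> R" "\<bar>x'\<bar> \<le> R" for w x x'
        using that by (intro lip) auto
      show ?thesis
        unfolding \<theta>(2)[symmetric]
        by (rule level_replace[OF kill, where s = s and c = c and C = C and \<eta> = \<eta> and \<theta> = \<theta>
              and R = R and M = M and n = n];
            fact n bounds Is lips C(1) c \<eta>(1) \<theta>(1) osc order_refl)
    qed
    then obtain D where D0: "\<And>e. e \<in> k \<Longrightarrow> compact (D e) \<and>
     D e \<subseteq> (\<Union>e\<in>level M (p e) ` {fst (p e)..fst e + d}. cball e (\<delta> / 2)) \<and>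
     (\<forall>u\<in>I. shift_proj F u ` level M (p e) ` {fst (p e)..fst e + d} \<subseteq> shift_proj F u ` D e) \<and>
     (\<forall>u\<in>B \<union> {w0<..M}. emeasure lborel (shift_proj F u ` D e) \<le> ennreal (\<epsilon> / card k))"
      by metis
    have D: "\<And>e. e \<in> k \<Longrightarrow> compact (D e)"
      "\<And>e. e \<in> k \<Longrightarrow> D e \<subseteq> (\<Union>e\<in>level M (p e) ` {fst (p e)..fst e + d}. cball e (\<delta> / 2))"
      "\<And>e u. e \<in> k \<Longrightarrow> u \<in> I \<Longrightarrow> shift_proj F u ` level M (p e) ` {fst (p e)..fst e + d} \<subseteq> shift_proj F u ` D e"
      "\<And>e u. e \<in> k \<Longrightarrow> u \<in> B \<union> {w0<..M} \<Longrightarrow> emeasure lborel (shift_proj F u ` D e) \<le> ennreal (\<epsilon> / card k)"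
      using D0 by simp_all
    show "\<exists>E'. compact E' \<and> E' \<subseteq> (\<Union>e\<in>E. cball e \<delta>) \<and>
       (\<forall>u\<in>I. shift_proj F u ` E \<subseteq> shift_proj F u ` E') \<and>
       (\<forall>u\<in>B \<union> {w0<..M}. emeasure lborel (shift_proj F u ` E') \<le> ennreal \<epsilon>)"
    proof (intro exI[of _ "\<Union>e\<in>k. D e"] conjI ballI)
      show "compact (\<Union>e\<in>k. D e)" using k(1) D(1) by (rule compact_UN)
      show "(\<Union>e\<in>k. D e) \<subseteq> (\<Union>e\<in>E. cball e \<delta>)"
      proof
        fix q assume "q \<in> (\<Union>e\<in>k. D e)"
        then obtain e x where e: "e \<in> k" "fst e \<le> x" "x \<le> fst e + d" "dist (level M (p e) x) q \<le> \<delta> / 2"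
          using D(2) by (fastforce simp: p)
        have "\<bar>F (M - fst e) - F (M - x)\<bar> \<le> C * \<bar>fst e - x\<bar>"
          using e ER[of e] k(2) sw0 M d\<delta> by (intro lip) auto
        also have "\<dots> \<le> C * d" using e(2,3) C(1) by (intro mult_left_mono) auto
        finally have "\<bar>F (M - fst e) - F (M - x)\<bar> \<le> C * d" .
        moreover have "snd e - snd (level M (p e) x) = (1 + C) * \<rho> - (F (M - fst e) - F (M - x))"
          by (simp add: level_def p_def)
        moreover have "0 \<le> (1 + C) * \<rho>" using \<rho>(1) C(1) by simp
        ultimately have "\<bar>snd e - snd (level M (p e) x)\<bar> \<le> (1 + C) * \<rho> + C * d"
          by linarith
        moreover have "\<bar>fst e - fst (level M (p e) x)\<bar> \<le> d" using e by simp
        ultimately have "dist e (level M (p e) x) \<le> (1 + C) * \<rho> + C * d + d"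
          using dist_prod_le[of e "level M (p e) x"] by linarith
        then have "dist e (level M (p e) x) \<le> (1 + C) * \<rho> + (1 + C) * d"
          by (simp add: algebra_simps)
        then have "dist e q \<le> \<delta>" using \<rho>d e(4) dist_triangle[of e q "level M (p e) x"] by linarith
        then show "q \<in> (\<Union>e\<in>E. cball e \<delta>)" using e(1) k(2) by auto
      qed
      show "shift_proj F u ` E \<subseteq> shift_proj F u ` (\<Union>e\<in>k. D e)" if u: "u \<in> I" for u
      proof
        fix v assume "v \<in> shift_proj F u ` E"
        then obtain q e where q: "v = shift_proj F u q" "q \<in> E" "e \<in> k" "dist e q < \<rho>"
          using k(3) by fastforce
        have us: "min r s \<le> u" "u \<le> s" using u I by auto
        have "\<bar>fst e\<bar> \<le> R" "\<bar>fst q\<bar> \<le> R"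
          using q(2,3) k(2) ER[of e] ER[of q] \<delta> by auto
        then have "\<bar>F (u - fst e) - F (u - fst q)\<bar> \<le> C * \<bar>fst e - fst q\<bar>"
          using us sw0 M by (intro lip) auto
        then have "\<bar>shift_proj F u e - shift_proj F u q\<bar> \<le> (1 + C) * dist e q"
          using C(1) by (rule shift_proj_lipschitz)
        also have "\<dots> \<le> (1 + C) * \<rho>" using q(4) C(1) by (intro mult_left_mono) auto
        finally have v: "\<bar>shift_proj F u e - v\<bar> \<le> (1 + C) * \<rho>" by (simp add: q)
        have "2 * (1 + C) * \<rho> = c * (fst e + d - fst e)" by (simp add: \<rho>(3))
        also have "\<dots> \<le> gain M s (fst e) (fst e + d)"
          using M ER[of e] q(3) k(2) \<rho>(2) d\<delta> \<delta> by (intro gain_ge c(2)) auto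
        also have "\<dots> \<le> gain M u (fst e) (fst e + d)"
          using gain_trans[of M s "fst e" "fst e + d" u] gain_nonneg[of "fst e" "fst e + d" u s] us \<rho>(2) by simp
        finally have "2 * ((1 + C) * \<rho>) \<le> gain M u (fst e) (fst e + d)" by (simp only: mult.assoc)
        then have "shift_proj F u e - (1 + C) * \<rho> \<le> v"
          "v \<le> shift_proj F u e - (1 + C) * \<rho> + gain M u (fst e) (fst e + d)"
          using v by linarith+
        then have "v \<in> shift_proj F u ` level M (p e) ` {fst (p e)..fst e + d}"
          using \<rho>(2) by (intro level_image_interval) (simp_all add: p)
        then have "v \<in> shift_proj F u ` D e" by (rule D(3)[OF q(3) u, THEN subsetD])
        with q(3) show "v \<in> shift_proj F u ` (\<Union>e\<in>k. D e)" unfolding image_UN by (rule UN_I)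
      qed
      show "emeasure lborel (shift_proj F u ` (\<Union>e\<in>k. D e)) \<le> ennreal \<epsilon>" if u: "u \<in> B \<union> {w0<..M}" for u
      proof -
        have "emeasure lborel (shift_proj F u ` (\<Union>e\<in>k. D e)) \<le> ennreal (\<Sum>e\<in>k. \<epsilon> / card k)"
          using \<epsilon> by (intro emeasure_shift_proj_UN_le cont k(1) D(1) D(4)[OF _ u]) simp_all
        also have "(\<Sum>e\<in>k. \<epsilon> / card k) \<le> \<epsilon>" using \<epsilon> by simp
        then have "ennreal (\<Sum>e\<in>k. \<epsilon> / card k) \<le> ennreal \<epsilon>" by (rule ennreal_leI)
        finally show ?thesis .
      qed
    qed
  qed
qed

section \<open>Abscissas on both sides, by reflection\<close>

lemma C1_strictly_convex_mirror: "C1_strictly_convex (\<lambda>t. F (- t)) (\<lambda>t. - F' (- t))"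
proof
  show "((\<lambda>t. F (- t)) has_real_derivative - F' (- t)) (at t)" for t
    using DERIV_chain2[OF deriv[of "- t"] DERIV_minus[OF DERIV_ident]] by simp
  show "continuous_on UNIV (\<lambda>t. - F' (- t))"
    by (intro continuous_intros continuous_on_compose2[OF cont_deriv]) auto
  show "strict_mono (\<lambda>t. - F' (- t))"
    using mono_deriv by (simp add: strict_mono_def)
qed

text \<open>The left part is obtained in the mirror image, starting from
  \<open>killable_empty\<close>; \<open>killable_above\<close> then adds the right part and keeps
  what was achieved on the left.\<close>

lemma killable_outside:
  assumes "w1 < r" "s < w0"
  shows "killable F {r..s} ({L..<w1} \<union> {w0<..M})"
proof -
  have "killable (\<lambda>t. F (- t)) {- s..- r} ({} \<union> {- w1<..- L})"
    by (rule C1_strictly_convex.killable_above[OF C1_strictly_convex_mirror killable_empty order_refl]) (use assms in simp)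
  then have "killable (\<lambda>t. F (- t)) (uminus ` {r..s}) (uminus ` {L..<w1})" by simp
  then have "killable F {r..s} {L..<w1}" by (rule killable_mirror[OF _ cont])
  then show ?thesis by (rule killable_above[OF _ order_refl assms(2)])
qed

end

section \<open>Local replacement for the graph\<close>

text \<open>Continue \<open>f'\<close> with slope one beyond both ends, take an antiderivative and
  fix its constant at \<open>a\<close>. With a function on the whole line, \<open>shift_proj\<close>
  makes sense at every abscissa and level curves have no end points.\<close>

lemma C1_strictly_convex_extension:
  fixes f f' :: "real \<Rightarrow> real"
  assumes "a < b"
    and deriv: "\<And>t. t \<in> {a..b} \<Longrightarrow> (f has_real_derivative f' t) (at t within {a..b})"
    and cont: "continuous_on {a..b} f'"
    and mono: "strict_mono_on {a..b} f'"
  shows "\<exists>F F'. C1_strictly_convex F F' \<and> (\<forall>t\<in>{a..b}. F t = f t)"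
proof -
  define c where "c t = min b (max a t)" for t
  define F' where "F' t = f' (c t) + (t - c t)" for t
  have c: "c t \<in> {a..b}" for t using \<open>a < b\<close> by (auto simp: c_def)
  have contF': "continuous_on UNIV F'"
    unfolding F'_def c_def
    by (intro continuous_intros continuous_on_compose2[OF cont]) (use \<open>a < b\<close> in auto)
  obtain G where "\<And>t. (G has_vector_derivative F' t) (at t)"
    using einterval_antiderivative[of "- \<infinity>" \<infinity> F'] contF' 
    by (force simp: continuous_on_eq_continuous_at)
  then have G: "(G has_real_derivative F' t) (at t)" for t
    by (simp add: has_real_derivative_iff_has_vector_derivative)
  define F where "F t = G t + (f a - G a)" for t
  have F: "(F has_real_derivative F' t) (at t)" for t
    unfolding F_def using DERIV_add[OF G DERIV_const] by simp
  have "strict_mono F'"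
  proof (rule strict_monoI)
    fix t u :: real assume "t < u"
    show "F' t < F' u"
    proof (cases "c t < c u")
      case True
      then have "f' (c t) < f' (c u)" using strict_mono_onD[OF mono c c] by blast
      moreover have "t - c t \<le> u - c u" using \<open>t < u\<close> True by (auto simp: c_def)
      ultimately show ?thesis by (simp add: F'_def)
    next
      case False
      then have "c t = c u" using \<open>t < u\<close> \<open>a < b\<close> by (auto simp: c_def min_def max_def split: if_splits)
      then show ?thesis using \<open>t < u\<close> by (simp add: F'_def)
    qed
  qed
  then have "C1_strictly_convex F F'" using F contF' by (simp add: C1_strictly_convex_def)
  moreover have "F t = f t" if t: "t \<in> {a..b}" for t
  proof -
    have "\<exists>k. \<forall>t\<in>{a..b}. F t - f t = k"
    proof (rule has_field_derivative_zero_constant)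
      fix t assume "t \<in> {a..b}"
      moreover from this have "c t = t" by (auto simp: c_def)
      ultimately show "((\<lambda>t. F t - f t) has_real_derivative 0) (at t within {a..b})"
        using DERIV_diff[OF has_field_derivative_at_within[OF F[of t]] deriv[of t]]
        by (simp add: F'_def)
    qed simp
    then obtain k where k: "\<And>t. t \<in> {a..b} \<Longrightarrow> F t - f t = k" by blast
    have "F a - f a = 0" by (simp add: F_def)
    then show ?thesis using k[of a] k[OF t] \<open>a < b\<close> by simp
  qed
  ultimately show ?thesis by blast
qed

lemma killable_extension:
  fixes f f' :: "real \<Rightarrow> real"
  assumes "a < b"
    and deriv: "\<And>t. t \<in> {a..b} \<Longrightarrow> (f has_real_derivative f' t) (at t within {a..b})"
    and cont: "continuous_on {a..b} f'"
    and mono: "strict_mono_on {a..b} f' \<or> strict_antimono_on {a..b} f'"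
  obtains F where "continuous_on UNIV F" "\<And>t. t \<in> {a..b} \<Longrightarrow> F t = f t"
    "\<And>w1 r s w0 L M. w1 < r \<Longrightarrow> s < w0 \<Longrightarrow> killable F {r..s} ({L..<w1} \<union> {w0<..M})"
  using mono
proof
  assume "strict_mono_on {a..b} f'"
  with \<open>a < b\<close> deriv cont have "\<exists>F F'. C1_strictly_convex F F' \<and> (\<forall>t\<in>{a..b}. F t = f t)"
    by (rule C1_strictly_convex_extension)
  then obtain F F' where F: "C1_strictly_convex F F'" "\<And>t. t \<in> {a..b} \<Longrightarrow> F t = f t"
    by blast
  show thesis
    by (rule that[OF C1_strictly_convex.cont[OF F(1)] F(2) C1_strictly_convex.killable_outside[OF F(1)]])
next
  assume "strict_antimono_on {a..b} f'"
  then have "strict_mono_on {a..b} (\<lambda>t. - f' t)"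
    by (auto simp: monotone_on_def)
  moreover have "((\<lambda>t. - f t) has_real_derivative - f' t) (at t within {a..b})" if "t \<in> {a..b}" for t
    using deriv[OF that] by (rule DERIV_minus)
  moreover have "continuous_on {a..b} (\<lambda>t. - f' t)" using cont by (rule continuous_on_minus)
  ultimately have "\<exists>F F'. C1_strictly_convex F F' \<and> (\<forall>t\<in>{a..b}. F t = - f t)"
    by (intro C1_strictly_convex_extension[OF \<open>a < b\<close>])
  then obtain F F' where F: "C1_strictly_convex F F'" "\<And>t. t \<in> {a..b} \<Longrightarrow> F t = - f t"
    by blast
  have c: "continuous_on UNIV (\<lambda>t. - F t)"
    by (intro continuous_on_minus C1_strictly_convex.cont[OF F(1)])
  show thesis
  proof (rule that[OF c])
    fix w1 r s w0 L M :: real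
    assume "w1 < r" "s < w0"
    then have "killable F {r..s} ({L..<w1} \<union> {w0<..M})"
      by (rule C1_strictly_convex.killable_outside[OF F(1)])
    then show "killable (\<lambda>t. - F t) {r..s} ({L..<w1} \<union> {w0<..M})"
      using killable_uminus[OF _ c] by simp
  qed (simp add: F(2))
qed

section \<open>From small slices to small planar measure\<close>

lemma compact_set_plus:
  fixes S T :: "'a::real_normed_vector set"
  assumes "compact S" "compact T"
  shows "compact (S + T)"
  using compact_sums[OF assms] by (simp add: set_plus_def Bex_def ac_simps)

lemma emeasure_lborel_prod_le:
  fixes X :: "(real \<times> real) set"
  assumes X: "X \<in> sets borel" and "l \<le> h" "0 \<le> \<epsilon>"
    and fst: "\<And>p. p \<in> X \<Longrightarrow> fst p \<in> {l..h}"
    and slice: "\<And>u. u \<in> fst ` X \<Longrightarrow> emeasure lborel (Pair u -` X) \<le> ennreal \<epsilon>"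
  shows "emeasure lborel X \<le> ennreal (\<epsilon> * (h - l))"
proof -
  have "emeasure lborel X = emeasure (lborel \<Otimes>\<^sub>M lborel) X"
    by (simp only: lborel_prod)
  also have "\<dots> = (\<integral>\<^sup>+u. emeasure lborel (Pair u -` X) \<partial>lborel)"
    using X by (intro lborel.emeasure_pair_measure_alt) (simp only: lborel_prod sets_lborel)
  also have "\<dots> \<le> (\<integral>\<^sup>+u. ennreal \<epsilon> * indicator {l..h} u \<partial>lborel)"
  proof (rule nn_integral_mono)
    fix u
    show "emeasure lborel (Pair u -` X) \<le> ennreal \<epsilon> * indicator {l..h} u"
    proof (cases "u \<in> fst ` X")
      case True
      then show ?thesis using fst slice[of u] by (auto simp: indicator_def)
    next
      case False
      then have "Pair u -` X = {}" by force
      then show ?thesis by simp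
    qed
  qed
  also have "\<dots> = ennreal \<epsilon> * ennreal (h - l)"
    using \<open>l \<le> h\<close> by (subst nn_integral_cmult_indicator) auto
  finally show ?thesis using assms by (simp add: ennreal_mult)
qed

text \<open>The radius \<open>r\<close> comes before \<open>\<epsilon>\<close>, so a countable
  subcover by such balls can be fixed first and the errors distributed afterwards. An open
  \<open>G'\<close> with compact closure inside \<open>G\<close> permits iteration and a compactness
  argument in the limit.\<close>

definition replaceable :: "(real \<times> real) set \<Rightarrow> bool" where
  "replaceable \<Gamma> \<longleftrightarrow> (\<forall>G V p. open G \<and> open V \<and> p \<in> G + \<Gamma> \<and> p \<in> V \<longrightarrow>
     (\<exists>r>0. \<forall>\<epsilon>>0. \<exists>G'. open G' \<and> compact (closure G') \<and> closure G' \<subseteq> G \<and>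
        ball p r \<subseteq> G' + \<Gamma> \<and> emeasure lborel ((closure G' + \<Gamma>) - V) \<le> ennreal \<epsilon>))"

text \<open>Outer regularity puts the waste into an open \<open>U\<close> of measure at most
  \<open>2 * \<epsilon>\<close>. The compact set \<open>E + \<Gamma>\<close> lies in the open set
  \<open>U \<union> V\<close>, and the sum stays there when \<open>E\<close> is enlarged a
  little.\<close>

lemma thicken_compact:
  fixes E \<Gamma> G V :: "(real \<times> real) set"
  assumes E: "compact E" "E \<subseteq> G" and \<Gamma>: "compact \<Gamma>" and "open G" "open V" and "0 < \<epsilon>"
    and small: "emeasure lborel ((E + \<Gamma>) - V) \<le> ennreal \<epsilon>"
  shows "\<exists>G'. open G' \<and> compact (closure G') \<and> closure G' \<subseteq> G \<and> E \<subseteq> G' \<and>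
    emeasure lborel ((closure G' + \<Gamma>) - V) \<le> ennreal (2 * \<epsilon>)"
proof -
  let ?X = "(E + \<Gamma>) - V"
  have X: "?X \<in> sets borel"
    using compact_set_plus[OF E(1) \<Gamma>] \<open>open V\<close> by (intro sets.Diff borel_compact borel_open)
  obtain U where U: "open U" "?X \<subseteq> U" "emeasure lborel (U - ?X) < ennreal \<epsilon>"
    using outer_regular_lborel[OF X \<open>0 < \<epsilon>\<close>] by metis
  have "emeasure lborel U = emeasure lborel (?X \<union> (U - ?X))"
    using U(2) by (simp add: Un_absorb1)
  also have "\<dots> \<le> emeasure lborel ?X + emeasure lborel (U - ?X)"
    using X U(1) by (intro emeasure_subadditive) auto
  also have "\<dots> \<le> ennreal \<epsilon> + ennreal \<epsilon>" using small U(3) by (intro add_mono) auto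
  also have "\<dots> = ennreal (2 * \<epsilon>)" using \<open>0 < \<epsilon>\<close> by (simp flip: ennreal_plus)
  finally have U_le: "emeasure lborel U \<le> ennreal (2 * \<epsilon>)" .
  obtain d1 where d1: "0 < d1" "(\<Union>x\<in>E + \<Gamma>. cball x d1) \<subseteq> U \<union> V"
    by (rule compact_subset_open_imp_cball_epsilon_subset[OF compact_set_plus[OF E(1) \<Gamma>], of "U \<union> V"])
       (use U \<open>open V\<close> in auto)
  obtain d2 where d2: "0 < d2" "(\<Union>x\<in>E. cball x d2) \<subseteq> G"
    by (rule compact_subset_open_imp_cball_epsilon_subset[OF E(1) \<open>open G\<close> E(2)])
  define d where "d = min d1 d2"
  have d: "0 < d" "d \<le> d1" "d \<le> d2" using d1 d2 by (auto simp: d_def)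
  define G' where "G' = (\<Union>x\<in>E. ball x d)"
  have "(\<Union>x\<in>E. cball x d) = E + cball 0 d"
  proof (intro set_eqI iffI)
    fix q assume "q \<in> (\<Union>x\<in>E. cball x d)"
    then obtain x where "x \<in> E" "dist x q \<le> d" by auto
    then have "q - x \<in> cball 0 d" by (simp add: dist_norm norm_minus_commute)
    then have "x + (q - x) \<in> E + cball 0 d" using \<open>x \<in> E\<close> by (intro set_plus_intro)
    then show "q \<in> E + cball 0 d" by simp
  next
    fix q assume "q \<in> E + cball 0 d"
    then obtain x y where "q = x + y" "x \<in> E" "norm y \<le> d" by (auto elim: set_plus_elim)
    then show "q \<in> (\<Union>x\<in>E. cball x d)" by (auto simp: dist_norm intro!: bexI[of _ x])
  qed
  then have T: "compact (\<Union>x\<in>E. cball x d)" using compact_set_plus[OF E(1) compact_cball] by simp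
  have cl: "closure G' \<subseteq> (\<Union>x\<in>E. cball x d)"
    unfolding G'_def using T by (intro closure_minimal compact_imp_closed) force+
  have "closure G' + \<Gamma> - V \<subseteq> U"
  proof
    fix q assume q: "q \<in> closure G' + \<Gamma> - V"
    then obtain e \<gamma> where "q = e + \<gamma>" "e \<in> closure G'" "\<gamma> \<in> \<Gamma>" by (auto elim: set_plus_elim)
    then obtain x where "x \<in> E" "dist x e \<le> d" using cl by auto
    then have "q \<in> cball (x + \<gamma>) d1" "x + \<gamma> \<in> E + \<Gamma>"
      using d \<open>q = e + \<gamma>\<close> \<open>\<gamma> \<in> \<Gamma>\<close> by auto
    then show "q \<in> U" using d1(2) q by blast
  qed
  then have "emeasure lborel (closure G' + \<Gamma> - V) \<le> ennreal (2 * \<epsilon>)"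
    using U(1) U_le by (intro order_trans[OF emeasure_mono U_le]) auto
  moreover have "open G'" "E \<subseteq> G'" using d(1) by (auto simp: G'_def)
  moreover have "compact (closure G')"
    using T cl by (metis closed_closure compact_Int_closed inf.absorb_iff2)
  moreover have "closure G' \<subseteq> G"
  proof -
    have "(\<Union>x\<in>E. cball x d) \<subseteq> (\<Union>x\<in>E. cball x d2)" using d by fastforce
    then show ?thesis using cl d2(2) by blast
  qed
  ultimately show ?thesis by blast
qed

lemma compact_graph_on:
  assumes "continuous_on {a..b} f"
  shows "compact (graph_on f {a..b})"
proof -
  have "graph_on f {a..b} = (\<lambda>t. (t, f t)) ` {a..b}" by (auto simp: graph_on_def)
  then show ?thesis
    using assms by (simp add: compact_continuous_image continuous_on_Pair)
qed

text \<open>A small disc of vectors around some \<open>e\<close> with \<open>p\<close> on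
  \<open>e + \<Gamma>\<close> covers a neighbourhood of \<open>p\<close>. It is replaced by a nearby
  compact set: near \<open>u0\<close> the slices lie in \<open>V\<close> and cost nothing, elsewhere
  they are small by \<open>kill\<close>, and Tonelli bounds the waste.\<close>

lemma replaceable_graph_on:
  assumes "a < b" and cont: "continuous_on UNIV F"
    and kill: "\<And>w1 r s w0 L M. w1 < r \<Longrightarrow> s < w0 \<Longrightarrow> killable F {r..s} ({L..<w1} \<union> {w0<..M})"
  shows "replaceable (graph_on F {a..b})"
  unfolding replaceable_def
proof (intro allI impI, elim conjE)
  let ?\<Gamma> = "graph_on F {a..b}"
  fix G V :: "(real \<times> real) set" and p
  assume "open G" "open V" and pG: "p \<in> G + ?\<Gamma>" and pV: "p \<in> V"
  define u0 where "u0 = fst p"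
  have \<Gamma>: "compact ?\<Gamma>" by (intro compact_graph_on continuous_on_subset[OF cont]) simp
  have contF: "continuous_on S (\<lambda>x. F (g x))" if "continuous_on S g" for S :: "'c::topological_space set" and g
    using continuous_on_compose2[OF cont that] by simp
  define h where "h t = (u0 - t, snd p - F t)" for t
  have "open (h -` G)"
    unfolding h_def using \<open>open G\<close> by (intro open_vimage continuous_intros contF)
  obtain t0 where t0: "t0 \<in> {a..b}" "h t0 \<in> G"
    using pG by (fastforce simp: graph_on_def h_def u0_def elim!: set_plus_elim)
  \<comment> \<open>\<open>h t\<close> moves the graph point over \<open>t\<close> onto
    \<open>p\<close>. Its parameter is pushed into the open interval, so that nearby vectors cover
    points near \<open>p\<close> by the graph over \<open>[a, b]\<close> and not by the
    extension.\<close>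
  then have "h -` G \<inter> closure {a<..<b} \<noteq> {}" using \<open>a < b\<close> by auto
  then have "h -` G \<inter> {a<..<b} \<noteq> {}"
    using open_Int_closure_eq_empty[OF \<open>open (h -` G)\<close>] by blast
  then obtain t1 where "t1 \<in> h -` G \<inter> {a<..<b}" by blast
  then have t1: "a < t1" "t1 < b" "h t1 \<in> G" by simp_all
  define e where "e = h t1"
  have e: "fst e = u0 - t1" "snd e = snd p - F t1" by (simp_all add: e_def h_def)
  obtain d1 where d1: "0 < d1" "cball e d1 \<subseteq> G"
    using \<open>open G\<close> t1(3) open_contains_cball_eq unfolding e_def by blast
  \<comment> \<open>\<open>g (u, q)\<close> is the point over \<open>u\<close> on the translate by
    \<open>q\<close> of the extended graph; by continuity it stays in \<open>V\<close> for
    \<open>(u, q)\<close> near \<open>(u0, e)\<close>.\<close>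
  define g where "g = (\<lambda>(u, q). (u, shift_proj F u q))"
  have "open (g -` V)"
    unfolding g_def shift_proj_def case_prod_beta using \<open>open V\<close>
    by (intro open_vimage continuous_intros contF)
  moreover have "(u0, e) \<in> g -` V"
    using pV by (simp add: g_def shift_proj_def e u0_def)
  ultimately obtain d2 where d2: "0 < d2" "cball (u0, e) d2 \<subseteq> g -` V"
    using open_contains_cball_eq by blast
  define \<rho> where "\<rho> = Min {d1 / 2, d2 / 4, (t1 - a) / 4, (b - t1) / 4}"
  have \<rho>: "0 < \<rho>" "2 * \<rho> \<le> d1" "4 * \<rho> \<le> d2" "4 * \<rho> \<le> t1 - a" "4 * \<rho> \<le> b - t1"
    using d1 d2 t1 by (auto simp: \<rho>_def min_def)
  \<comment> \<open>\<open>[l, m]\<close> contains all abscissas of the sum, as the replacement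
    stays within \<open>2 * \<rho>\<close> of \<open>e\<close>. Covering is required up to distance
    \<open>\<rho>\<close> from \<open>u0\<close>, and \<open>V\<close> absorbs the slices up to
    \<open>2 * \<rho>\<close>; this leaves the gap that \<open>kill\<close> demands.\<close>
  define l where "l = fst e - 2 * \<rho> + a"
  define m where "m = fst e + 2 * \<rho> + b"
  have "l < m" using \<rho> \<open>a < b\<close> by (simp add: l_def m_def)
  define B where "B = {l..<u0 - 2 * \<rho>} \<union> {u0 + 2 * \<rho><..m}"
  have kill': "killable F {u0 - \<rho>..u0 + \<rho>} B"
    unfolding B_def using \<rho>(1) by (intro kill) auto
  have inV: "(u, shift_proj F u q) \<in> V" if "\<bar>u - u0\<bar> \<le> 2 * \<rho>" "dist e q \<le> 2 * \<rho>" for u q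
  proof -
    have "dist (u0, e) (u, q) \<le> \<bar>u0 - u\<bar> + dist e q"
      using sqrt_sum_squares_le_sum_abs[of "dist u0 u" "dist e q"]
      unfolding dist_Pair_Pair by (simp add: dist_real_def)
    then have "(u, q) \<in> cball (u0, e) d2" using that \<rho>(3) by simp
    then show ?thesis using d2(2) by (auto simp: g_def)
  qed
  show "\<exists>r>0. \<forall>\<epsilon>>0. \<exists>G'. open G' \<and> compact (closure G') \<and> closure G' \<subseteq> G \<and>
        ball p r \<subseteq> G' + ?\<Gamma> \<and> emeasure lborel ((closure G' + ?\<Gamma>) - V) \<le> ennreal \<epsilon>"
  proof (intro exI[of _ \<rho>] conjI allI impI)
    show "0 < \<rho>" by (rule \<rho>)
    fix \<epsilon> :: real assume "0 < \<epsilon>"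
    \<comment> \<open>Only half of \<open>\<epsilon>\<close> is spent, since
      \<open>thicken_compact\<close> doubles the bound.\<close>
    define \<theta> where "\<theta> = \<epsilon> / 2 / (m - l)"
    have \<theta>: "0 < \<theta>" "\<theta> * (m - l) = \<epsilon> / 2"
    proof -
      have "0 < m - l" using \<open>l < m\<close> by simp
      then show "0 < \<theta>" unfolding \<theta>_def using \<open>0 < \<epsilon>\<close> by (intro divide_pos_pos) auto
      show "\<theta> * (m - l) = \<epsilon> / 2"
        using \<open>0 < m - l\<close> \<theta>_def by (metis less_irrefl nonzero_divide_eq_eq)
    qed
    obtain E where E: "compact E" "E \<subseteq> (\<Union>q\<in>cball e \<rho>. cball q \<rho>)"
      "\<And>u. u \<in> {u0 - \<rho>..u0 + \<rho>} \<Longrightarrow> shift_proj F u ` cball e \<rho> \<subseteq> shift_proj F u ` E"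
      "\<And>u. u \<in> B \<Longrightarrow> emeasure lborel (shift_proj F u ` E) \<le> ennreal \<theta>"
      using killableD[OF kill' compact_cball[of e \<rho>] \<rho>(1) \<theta>(1)] by blast
    have Ee: "dist e q \<le> 2 * \<rho>" if "q \<in> E" for q
    proof -
      from that E(2) obtain q' where "dist e q' \<le> \<rho>" "dist q' q \<le> \<rho>" by auto
      then show ?thesis using dist_triangle[of e q q'] by simp
    qed
    then have EG: "E \<subseteq> G" using d1(2) \<rho>(2) by force
    have cover: "ball p \<rho> \<subseteq> E + ?\<Gamma>"
    proof
      fix q assume q: "q \<in> ball p \<rho>"
      \<comment> \<open>The translate by \<open>z\<close> passes through \<open>q\<close>, so
        \<open>snd q\<close> is a projection of the disc over \<open>fst q\<close>, and some
        \<open>x\<close> in \<open>E\<close> takes over.\<close>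
      define z where "z = q - (t1, F t1)"
      have "e = p - (t1, F t1)" by (simp add: e_def h_def u0_def prod_eq_iff)
      then have "dist e z = dist p q" by (simp add: z_def dist_norm)
      then have "z \<in> cball e \<rho>" using q by simp
      moreover have qu: "\<bar>fst q - u0\<bar> \<le> \<rho>"
        using q abs_fst_diff_le_dist[of p q] by (simp add: u0_def)
      ultimately have "shift_proj F (fst q) z \<in> shift_proj F (fst q) ` E"
        using E(3)[of "fst q"] by (auto simp: abs_le_iff)
      then obtain x where x: "x \<in> E" "shift_proj F (fst q) x = snd q"
        by (auto simp: shift_proj_def z_def)
      have "\<bar>fst e - fst x\<bar> \<le> 2 * \<rho>" using Ee[OF x(1)] abs_fst_diff_le_dist[of e x] by simp
      then have "fst q - fst x \<in> {a..b}" using qu \<rho> unfolding e abs_le_iff by simp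
      then have "(fst q - fst x, F (fst q - fst x)) \<in> ?\<Gamma>" by (auto simp: graph_on_def)
      then have "x + (fst q - fst x, F (fst q - fst x)) \<in> E + ?\<Gamma>" using x(1) by (intro set_plus_intro)
      also have "x + (fst q - fst x, F (fst q - fst x)) = q"
        using x(2) by (simp add: prod_eq_iff shift_proj_def)
      finally show "q \<in> E + ?\<Gamma>" .
    qed
    have "emeasure lborel ((E + ?\<Gamma>) - V) \<le> ennreal (\<theta> * (m - l))"
    proof (rule emeasure_lborel_prod_le)
      show "(E + ?\<Gamma>) - V \<in> sets borel"
        using compact_set_plus[OF E(1) \<Gamma>] \<open>open V\<close> by (intro sets.Diff borel_compact borel_open)
      have pt: "fst q \<in> {l..m} \<and> snd q \<in> shift_proj F (fst q) ` E \<and> fst q \<in> B"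
        if q: "q \<in> (E + ?\<Gamma>) - V" for q
      proof -
        from q obtain x t where x: "x \<in> E" "t \<in> {a..b}" "q = x + (t, F t)"
          by (auto simp: graph_on_def elim!: set_plus_elim)
        have "\<bar>fst e - fst x\<bar> \<le> 2 * \<rho>" using Ee[OF x(1)] abs_fst_diff_le_dist[of e x] by simp
        then have 1: "fst q \<in> {l..m}" using x(2,3) by (simp add: l_def m_def abs_le_iff)
        have 2: "shift_proj F (fst q) x = snd q" using x(3) by (simp add: shift_proj_def)
        have "\<not> \<bar>fst q - u0\<bar> \<le> 2 * \<rho>"
          using inV[of "fst q" x] Ee[OF x(1)] 2 q by auto
        then have "fst q \<in> B" using 1 by (auto simp: B_def abs_le_iff)
        then show ?thesis using 1 2 x(1) by (metis imageI)
      qed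
      show "fst q \<in> {l..m}" if "q \<in> (E + ?\<Gamma>) - V" for q using pt[OF that] by simp
      show "emeasure lborel (Pair u -` ((E + ?\<Gamma>) - V)) \<le> ennreal \<theta>" if "u \<in> fst ` ((E + ?\<Gamma>) - V)" for u
      proof -
        have "u \<in> B" using that pt by auto
        moreover have "Pair u -` ((E + ?\<Gamma>) - V) \<subseteq> shift_proj F u ` E" using pt by fastforce
        ultimately show ?thesis
          using E(4)[of u] sets_shift_proj_image[OF cont E(1)] by (meson emeasure_mono order_trans)
      qed
    qed (use \<open>l < m\<close> \<theta> in auto)
    then have "emeasure lborel ((E + ?\<Gamma>) - V) \<le> ennreal (\<epsilon> / 2)" by (simp only: \<theta>(2))
    then obtain G' where G': "open G'" "compact (closure G')" "closure G' \<subseteq> G" "E \<subseteq> G'"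
      "emeasure lborel ((closure G' + ?\<Gamma>) - V) \<le> ennreal (2 * (\<epsilon> / 2))"
      using thicken_compact[OF E(1) EG \<Gamma> \<open>open G\<close> \<open>open V\<close>, of "\<epsilon> / 2"] \<open>0 < \<epsilon>\<close> by auto
    moreover have "ball p \<rho> \<subseteq> G' + ?\<Gamma>"
      using cover set_plus_mono2[OF G'(4) order_refl] by (rule order_trans)
    ultimately show "\<exists>G'. open G' \<and> compact (closure G') \<and> closure G' \<subseteq> G \<and>
        ball p \<rho> \<subseteq> G' + ?\<Gamma> \<and> emeasure lborel ((closure G' + ?\<Gamma>) - V) \<le> ennreal \<epsilon>"
      by auto
  qed
qed

section \<open>Efficient coverings\<close>

lemma emeasure_UN_half_le:
  fixes A :: "nat \<Rightarrow> 'a set"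
  assumes "\<And>n. A n \<in> sets M" "0 \<le> \<epsilon>" "\<And>n. emeasure M (A n) \<le> ennreal (\<epsilon> * (1/2) ^ Suc n)"
  shows "emeasure M (\<Union>n. A n) \<le> ennreal \<epsilon>"
proof -
  have "emeasure M (\<Union>n. A n) \<le> (\<Sum>n. emeasure M (A n))"
    using assms by (intro emeasure_subadditive_countably) auto
  also have "\<dots> \<le> (\<Sum>n. ennreal (\<epsilon> * (1/2) ^ Suc n))"
    using assms by (intro suminf_le) auto
  also have "\<dots> = ennreal (\<epsilon> * 1)"
    using assms by (intro suminf_ennreal_eq sums_mult power_half_series) auto
  finally show ?thesis by simp
qed

lemma sets_compact_set_plus_Diff:
  fixes S T V :: "(real \<times> real) set"
  assumes "compact S" "compact T" "open V"
  shows "S + T - V \<in> sets borel"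
  using assms by (intro sets.Diff borel_compact compact_set_plus borel_open)

text \<open>The Lindelof property selects countably many of the balls; the \<open>n\<close>-th one
  gets the error \<open>\<epsilon> * (1/2) ^ Suc n\<close>.\<close>

lemma replaceable_countable:
  assumes \<Gamma>: "replaceable \<Gamma>" "compact \<Gamma>" and "open G" "open V" "0 < \<epsilon>"
  shows "\<exists>H :: nat \<Rightarrow> _. (\<forall>n. open (H n) \<and> compact (closure (H n)) \<and> closure (H n) \<subseteq> G) \<and>
    (G + \<Gamma>) \<inter> V \<subseteq> (\<Union>n. H n + \<Gamma>) \<and>
    emeasure lborel (\<Union>n. closure (H n) + \<Gamma> - V) \<le> ennreal \<epsilon>"
proof -
  let ?A = "(G + \<Gamma>) \<inter> V"
  have "\<exists>r>0. \<forall>\<epsilon>>0. \<exists>G'. open G' \<and> compact (closure G') \<and> closure G' \<subseteq> G \<and>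
        ball p r \<subseteq> G' + \<Gamma> \<and> emeasure lborel ((closure G' + \<Gamma>) - V) \<le> ennreal \<epsilon>" if "p \<in> ?A" for p
    using \<Gamma>(1) assms(3,4) that unfolding replaceable_def by blast
  then obtain r where r: "\<And>p. p \<in> ?A \<Longrightarrow> 0 < r p" "\<And>p \<epsilon>. p \<in> ?A \<Longrightarrow> 0 < \<epsilon> \<Longrightarrow>
      \<exists>G'. open G' \<and> compact (closure G') \<and> closure G' \<subseteq> G \<and>
        ball p (r p) \<subseteq> G' + \<Gamma> \<and> emeasure lborel ((closure G' + \<Gamma>) - V) \<le> ennreal \<epsilon>"
    by metis
  let ?b = "\<lambda>p. ball p (r p)"
  have "open S" if "S \<in> ?b ` ?A" for S using that by auto
  then obtain \<B> where \<B>: "\<B> \<subseteq> ?b ` ?A" "countable \<B>" "\<Union>\<B> = \<Union>(?b ` ?A)"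
    by (rule Lindelof)
  then have "\<exists>P. countable P \<and> P \<subseteq> ?A \<and> \<B> = ?b ` P"
    by (intro countable_subset_image[THEN iffD1] conjI)
  then obtain P where P: "countable P" "P \<subseteq> ?A" "\<B> = ?b ` P" by blast
  define p where "p = from_nat_into P"
  have "\<exists>G'. open G' \<and> compact (closure G') \<and> closure G' \<subseteq> G \<and> (p n \<in> ?A \<longrightarrow> ball (p n) (r (p n)) \<subseteq> G' + \<Gamma>) \<and>
      emeasure lborel ((closure G' + \<Gamma>) - V) \<le> ennreal (\<epsilon> * (1/2) ^ Suc n)" for n
  proof (cases "p n \<in> ?A")
    case True
    have "0 < \<epsilon> * (1/2) ^ Suc n" using \<open>0 < \<epsilon>\<close> by simp
    from r(2)[OF True this] show ?thesis by blast
  next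
    \<comment> \<open>This occurs only for empty \<open>P\<close>, where
      \<open>from_nat_into\<close> returns an arbitrary value.\<close>
    case False
    have "{} + \<Gamma> = {}" by (auto simp: set_plus_def)
    then show ?thesis using False by (intro exI[of _ "{}"] conjI impI) auto
  qed
  then obtain H where H: "\<And>n. open (H n) \<and> compact (closure (H n)) \<and> closure (H n) \<subseteq> G \<and>
      (p n \<in> ?A \<longrightarrow> ball (p n) (r (p n)) \<subseteq> H n + \<Gamma>) \<and>
      emeasure lborel ((closure (H n) + \<Gamma>) - V) \<le> ennreal (\<epsilon> * (1/2) ^ Suc n)"
    by metis
  have "?A \<subseteq> (\<Union>n. H n + \<Gamma>)"
  proof
    fix w assume "w \<in> ?A"
    then have "w \<in> \<Union>\<B>" using r(1)[of w] unfolding \<B>(3) by (intro UN_I) auto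
    then obtain q where q: "q \<in> P" "w \<in> ball q (r q)" using P(3) by auto
    then obtain n where "p n = q" using from_nat_into_surj[OF P(1)] unfolding p_def by blast
    then show "w \<in> (\<Union>n. H n + \<Gamma>)" using H[of n] q P(2) by blast
  qed
  moreover have "emeasure lborel (\<Union>n. closure (H n) + \<Gamma> - V) \<le> ennreal \<epsilon>"
    using H \<open>0 < \<epsilon>\<close> sets_compact_set_plus_Diff[OF _ \<Gamma>(2) \<open>open V\<close>]
    by (intro emeasure_UN_half_le) (simp_all add: less_imp_le)
  ultimately show ?thesis using H by (intro exI[of _ H]) simp
qed

text \<open>One step of the tree: each set of a level is treated with its own share of
  \<open>\<epsilon>\<close>, and the resulting pairs are renumbered into a single sequence. The
  inclusion \<open>closure (Q' j) \<subseteq> Q m\<close> links a child to its parent, so that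
  branches can be followed.\<close>

lemma replaceable_sequence:
  fixes Q :: "nat \<Rightarrow> (real \<times> real) set"
  assumes \<Gamma>: "replaceable \<Gamma>" "compact \<Gamma>" and Q: "\<And>m. open (Q m)" and "open V" "0 < \<epsilon>"
  shows "\<exists>Q' :: nat \<Rightarrow> _. (\<forall>j. open (Q' j) \<and> compact (closure (Q' j))) \<and>
    (\<forall>m. \<forall>w\<in>(Q m + \<Gamma>) \<inter> V. \<exists>j. w \<in> Q' j + \<Gamma> \<and> closure (Q' j) \<subseteq> Q m) \<and>
    emeasure lborel (\<Union>j. closure (Q' j) + \<Gamma> - V) \<le> ennreal \<epsilon>"
proof -
  have "\<exists>H :: nat \<Rightarrow> _. (\<forall>n. open (H n) \<and> compact (closure (H n)) \<and> closure (H n) \<subseteq> Q m) \<and>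
    (Q m + \<Gamma>) \<inter> V \<subseteq> (\<Union>n. H n + \<Gamma>) \<and>
    emeasure lborel (\<Union>n. closure (H n) + \<Gamma> - V) \<le> ennreal (\<epsilon> * (1/2) ^ Suc m)" for m
    using \<open>0 < \<epsilon>\<close> by (intro replaceable_countable[OF \<Gamma> Q \<open>open V\<close>]) simp
  then obtain H :: "nat \<Rightarrow> nat \<Rightarrow> _" where
    H: "\<And>m n. open (H m n) \<and> compact (closure (H m n)) \<and> closure (H m n) \<subseteq> Q m"
       "\<And>m. (Q m + \<Gamma>) \<inter> V \<subseteq> (\<Union>n. H m n + \<Gamma>)"
       "\<And>m. emeasure lborel (\<Union>n. closure (H m n) + \<Gamma> - V) \<le> ennreal (\<epsilon> * (1/2) ^ Suc m)"
    by metis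
  define Q' where "Q' j = case_prod H (prod_decode j)" for j
  have Q': "Q' (prod_encode (m, n)) = H m n" for m n by (simp add: Q'_def)
  have "\<exists>j. w \<in> Q' j + \<Gamma> \<and> closure (Q' j) \<subseteq> Q m" if w: "w \<in> (Q m + \<Gamma>) \<inter> V" for m w
  proof -
    obtain n where "w \<in> H m n + \<Gamma>" using H(2)[of m] w by blast
    then show ?thesis using H(1)[of m n] Q'[of m n] by metis
  qed
  moreover have "emeasure lborel (\<Union>j. closure (Q' j) + \<Gamma> - V) \<le> ennreal \<epsilon>"
  proof -
    have "(\<Union>j. closure (Q' j) + \<Gamma> - V) \<subseteq> (\<Union>m. \<Union>n. closure (H m n) + \<Gamma> - V)"
      by (fastforce simp: Q'_def split: prod.splits)
    moreover have s: "(\<Union>n. closure (H m n) + \<Gamma> - V) \<in> sets lborel" for m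
      using sets_compact_set_plus_Diff[OF _ \<Gamma>(2) \<open>open V\<close>] H(1) by (intro sets.countable_UN) auto
    moreover have "emeasure lborel (\<Union>m. \<Union>n. closure (H m n) + \<Gamma> - V) \<le> ennreal \<epsilon>"
      using \<open>0 < \<epsilon>\<close> by (intro emeasure_UN_half_le[OF s _ H(3)]) simp
    moreover have "(\<Union>m. \<Union>n. closure (H m n) + \<Gamma> - V) \<in> sets lborel"
      using s by (intro sets.countable_UN) auto
    ultimately show ?thesis by (blast intro: order_trans[OF emeasure_mono])
  qed
  moreover have "open (Q' j) \<and> compact (closure (Q' j))" for j
    using H(1) by (simp add: Q'_def split: prod.splits)
  ultimately show ?thesis by (intro exI[of _ Q']) blast
qed

text \<open>The vectors in \<open>D k\<close> whose translate of \<open>\<Gamma>\<close> hits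
  \<open>w\<close> form a decreasing sequence of nonempty compact sets.\<close>

lemma nested_compact_point:
  fixes D :: "nat \<Rightarrow> (real \<times> real) set"
  assumes "closed \<Gamma>" "\<And>k. compact (D k)" "\<And>k. D (Suc k) \<subseteq> D k" "\<And>k. w \<in> D k + \<Gamma>"
  shows "w \<in> (\<Inter>k. D k) + \<Gamma>"
proof -
  define K where "K k = D k \<inter> (\<lambda>e. w - e) -` \<Gamma>" for k
  have "closed ((\<lambda>e. w - e) -` \<Gamma>)"
    using \<open>closed \<Gamma>\<close> by (intro closed_vimage continuous_intros)
  then have "compact (K k)" for k unfolding K_def using assms(2) by (intro compact_Int_closed)
  moreover have "K k \<noteq> {}" for k
    using assms(4)[of k] unfolding K_def by (fastforce elim: set_plus_elim)
  moreover have "K n \<subseteq> K m" if "m \<le> n" for m n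
    using lift_Suc_antimono_le[of D, OF assms(3) that] by (auto simp: K_def)
  ultimately have "\<Inter>(range K) \<noteq> {}" by (intro compact_nest) auto
  then obtain e where "\<And>k. e \<in> K k" by blast
  then have "e \<in> (\<Inter>k. D k)" "w - e \<in> \<Gamma>" by (auto simp: K_def)
  then have "e + (w - e) \<in> (\<Inter>k. D k) + \<Gamma>" by (rule set_plus_intro)
  then show ?thesis by simp
qed

text \<open>Each \<open>V k\<close> exceeds \<open>W\<close> by less than \<open>(1/2) ^ k\<close>,
  and level \<open>Suc k\<close> of the tree wastes at most as much outside \<open>V k\<close>. A
  point of \<open>W\<close> lies in all \<open>V k\<close>, so a branch covering it can be followed
  forever, whereas \<open>E\<close> lies in the union of every level and inherits all the
  bounds.\<close>

lemma efficient_covering: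
  fixes W \<Gamma> :: "(real \<times> real) set"
  assumes \<Gamma>: "replaceable \<Gamma>" "compact \<Gamma>" "\<Gamma> \<noteq> {}" and W: "W \<in> sets lebesgue"
  shows "\<exists>E. W \<subseteq> E + \<Gamma> \<and> (E + \<Gamma>) - W \<in> null_sets lebesgue"
proof -
  have "\<exists>V. open V \<and> W \<subseteq> V \<and> V - W \<in> lmeasurable \<and> emeasure lebesgue (V - W) < ennreal ((1/2) ^ k)" for k
    using sets_lebesgue_outer_open[OF W, of "(1/2) ^ k"] by (metis zero_less_divide_1_iff zero_less_numeral zero_less_power)
  then obtain V where V: "\<And>k. open (V k)" "\<And>k. W \<subseteq> V k" "\<And>k. V k - W \<in> lmeasurable"
    "\<And>k. emeasure lebesgue (V k - W) < ennreal ((1/2) ^ k)" by metis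
  define R where "R k Q Q' \<longleftrightarrow> (\<forall>j. open (Q' j) \<and> compact (closure (Q' j))) \<and>
      (\<forall>m. \<forall>w\<in>(Q m + \<Gamma>) \<inter> V k. \<exists>j. w \<in> Q' j + \<Gamma> \<and> closure (Q' j) \<subseteq> Q m) \<and>
      emeasure lborel (\<Union>j. closure (Q' j) + \<Gamma> - V k) \<le> ennreal ((1/2) ^ k)"
    for k and Q Q' :: "nat \<Rightarrow> (real \<times> real) set"
  \<comment> \<open>The clause for \<open>k = 0\<close> pins down the root of the tree, because
    dependent choice returns only the invariant and the relation between successive levels.\<close>
  have "\<exists>Q. \<forall>k. ((\<forall>m. open (Q k m)) \<and> (k = 0 \<longrightarrow> Q k = (\<lambda>m. UNIV))) \<and> R k (Q k) (Q (Suc k))"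
  proof (rule dependent_nat_choice)
    fix Q :: "nat \<Rightarrow> (real \<times> real) set" and k :: nat
    assume "(\<forall>m. open (Q m)) \<and> (k = 0 \<longrightarrow> Q = (\<lambda>m. UNIV))"
    then have "\<exists>Q'. R k Q Q'"
      unfolding R_def by (intro replaceable_sequence[OF \<Gamma>(1,2) _ V(1)]) auto
    then show "\<exists>Q'. ((\<forall>m. open (Q' m)) \<and> (Suc k = 0 \<longrightarrow> Q' = (\<lambda>m. UNIV))) \<and> R k Q Q'"
      unfolding R_def by blast
  qed (auto intro: exI[of _ "\<lambda>m. UNIV"])
  then obtain Q where Q: "\<And>k. k = 0 \<longrightarrow> Q k = (\<lambda>m. UNIV)" "\<And>k. R k (Q k) (Q (Suc k))"
    by blast
  have Q0: "Q 0 = (\<lambda>m. UNIV)" using Q(1) by blast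
  have Q1: "\<And>k j. compact (closure (Q (Suc k) j))"
    and Q2: "\<And>k m w. w \<in> Q k m + \<Gamma> \<Longrightarrow> w \<in> V k \<Longrightarrow> \<exists>j. w \<in> Q (Suc k) j + \<Gamma> \<and> closure (Q (Suc k) j) \<subseteq> Q k m"
    and Q3: "\<And>k. emeasure lborel (\<Union>j. closure (Q (Suc k) j) + \<Gamma> - V k) \<le> ennreal ((1/2) ^ k)"
    using Q(2) unfolding R_def by blast+
  define E where "E = (\<Inter>k. \<Union>m. Q k m)"
  have "W \<subseteq> E + \<Gamma>"
  proof
    fix w assume "w \<in> W"
    have "\<exists>m. \<forall>k. w \<in> Q k (m k) + \<Gamma> \<and> closure (Q (Suc k) (m (Suc k))) \<subseteq> Q k (m k)"
    proof (rule dependent_nat_choice)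
      obtain \<gamma> where "\<gamma> \<in> \<Gamma>" using \<Gamma>(3) by blast
      then have "(w - \<gamma>) + \<gamma> \<in> Q 0 0 + \<Gamma>" unfolding Q0 by (intro set_plus_intro) auto
      then show "\<exists>m. w \<in> Q 0 m + \<Gamma>" by auto
    next
      fix m k assume "w \<in> Q k m + \<Gamma>"
      then show "\<exists>j. w \<in> Q (Suc k) j + \<Gamma> \<and> closure (Q (Suc k) j) \<subseteq> Q k m"
        using Q2 V(2) \<open>w \<in> W\<close> by blast
    qed
    then obtain m where m: "\<And>k. w \<in> Q k (m k) + \<Gamma>" "\<And>k. closure (Q (Suc k) (m (Suc k))) \<subseteq> Q k (m k)"
      by blast
    \<comment> \<open>The index is shifted by one since the root is the whole plane, which is not
      compact; \<open>D k\<close> still lies in \<open>Q k (m k)\<close>.\<close>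
    define D where "D k = closure (Q (Suc k) (m (Suc k)))" for k
    have "w \<in> (\<Inter>k. D k) + \<Gamma>"
    proof (rule nested_compact_point)
      show "closed \<Gamma>" using \<Gamma>(2) by (rule compact_imp_closed)
      show "compact (D k)" for k using Q1 by (simp add: D_def)
      show "D (Suc k) \<subseteq> D k" for k
        using m(2)[of "Suc k"] closure_subset unfolding D_def by blast
      show "w \<in> D k + \<Gamma>" for k
        using m(1)[of "Suc k"] set_plus_mono2[OF closure_subset order_refl] unfolding D_def by blast
    qed
    moreover have "(\<Inter>k. D k) \<subseteq> E" using m(2) by (auto simp: D_def E_def)
    ultimately show "w \<in> E + \<Gamma>" using set_plus_mono2[OF _ order_refl] by blast
  qed
  moreover have "negligible ((E + \<Gamma>) - W)"
    unfolding negligible_outer_le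
  proof (intro allI impI)
    fix e :: real assume "0 < e"
    then obtain k where k: "(1/2) ^ k < e / 2"
      using real_arch_pow_inv[of "e / 2" "1/2"] by auto
    define X where "X = (\<Union>j. closure (Q (Suc k) j) + \<Gamma> - V k)"
    define T where "T = X \<union> (V k - W)"
    have X: "X \<in> sets borel"
      unfolding X_def using sets_compact_set_plus_Diff[OF Q1 \<Gamma>(2) V(1)] by (intro sets.countable_UN) auto
    have "E + \<Gamma> \<subseteq> (\<Union>j. closure (Q (Suc k) j) + \<Gamma>)"
    proof
      fix q assume "q \<in> E + \<Gamma>"
      then obtain x \<gamma> where x: "x \<in> E" "\<gamma> \<in> \<Gamma>" "q = x + \<gamma>" by (auto elim: set_plus_elim)
      then obtain j where "x \<in> Q (Suc k) j" by (auto simp: E_def)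
      then have "q \<in> closure (Q (Suc k) j) + \<Gamma>" 
        using x closure_subset by (auto intro!: set_plus_intro)
      then show "q \<in> (\<Union>j. closure (Q (Suc k) j) + \<Gamma>)" by blast
    qed
    then have "(E + \<Gamma>) - W \<subseteq> T" by (auto simp: T_def X_def)
    moreover have Tm: "T \<in> sets lebesgue"
      unfolding T_def using X V(3) by (intro sets.Un) (auto simp: fmeasurable_def)
    moreover have T: "emeasure lebesgue T \<le> ennreal e"
    proof -
      have "emeasure lebesgue T \<le> emeasure lebesgue X + emeasure lebesgue (V k - W)"
        unfolding T_def using X V(3)[of k] by (intro emeasure_subadditive) (auto simp: fmeasurable_def)
      also have "\<dots> \<le> ennreal ((1/2) ^ k) + ennreal ((1/2) ^ k)"
        using Q3[of k] V(4)[of k] X by (intro add_mono) (auto simp: X_def)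
      also have "\<dots> = ennreal ((1/2) ^ k + (1/2) ^ k)" by (simp flip: ennreal_plus)
      also have "\<dots> \<le> ennreal e" using k by (intro ennreal_leI) simp
      finally show ?thesis .
    qed
    ultimately show "\<exists>T. (E + \<Gamma>) - W \<subseteq> T \<and> T \<in> lmeasurable \<and> measure lebesgue T \<le> e"
      using \<open>0 < e\<close>
      by (intro exI[of _ T] conjI fmeasurableI)
         (auto simp: measure_def enn2real_leI less_le_trans intro: le_less_trans)
  qed
  ultimately show ?thesis by (auto simp: negligible_iff_null_sets)
qed

theorem theorem1p1:
  fixes W :: "(real \<times> real) set" and a b :: real and f f' :: "real \<Rightarrow> real"
  assumes "W \<in> sets lebesgue"
    and "a < b"
    and "\<And>t. t \<in> {a..b} \<Longrightarrow> (f has_real_derivative f' t) (at t within {a..b})"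
    and "continuous_on {a..b} f'"
    and "strict_mono_on {a..b} f' \<or> strict_antimono_on {a..b} f'"
  shows "\<exists>E :: (real \<times> real) set.
           W \<subseteq> E + graph_on f {a..b} \<and>
           (E + graph_on f {a..b}) - W \<in> null_sets lebesgue"
proof -
  obtain F where F: "continuous_on UNIV F" "\<And>t. t \<in> {a..b} \<Longrightarrow> F t = f t"
    "\<And>w1 r s w0 L M. w1 < r \<Longrightarrow> s < w0 \<Longrightarrow> killable F {r..s} ({L..<w1} \<union> {w0<..M})"
    using killable_extension[OF assms(2-5)] by blast
  have eq: "graph_on f {a..b} = graph_on F {a..b}" using F(2) by (auto simp: graph_on_def)
  have "graph_on F {a..b} \<noteq> {}" using assms(2) by (auto simp: graph_on_def)
  moreover have "compact (graph_on F {a..b})"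
    by (intro compact_graph_on continuous_on_subset[OF F(1)]) simp
  moreover have "replaceable (graph_on F {a..b})"
    by (rule replaceable_graph_on[OF assms(2) F(1,3)])
  ultimately show ?thesis using efficient_covering[OF _ _ _ assms(1)] unfolding eq by blast
qed

end
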